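(* Let $\mathcal{C}$ be a Barr exact category with binary sums (coproducts). Then $\mathcal{C}$ is an abelian category if and only if both $\mathcal{C}$ and its dual category $\mathcal{C}^{\mathrm{op}}$ are subtractive.
   Context: A Barr exact category is a regular category (in particular it has finite limits) in which every internal equivalence relation is a kernel pair. A category is pointed if it has a terminal object and an initial object and these coincide (a zero object); $0$ denotes the zero morphism between any two objects. Subtractive category (being pointed is part of the definition): a pointed category $\mathcal{C}$ with binary products is subtractive if for any object $A$ and any monomorphism (subobject) $r:R\to A\times A$ the following holds: if there exist morphisms $f_1,f_2:A\to R$ with $rf_1=(1_A,1_A)$ and $rf_2=(1_A,0)$, then there exists a morphism $f_3:A\to R$ with $rf_3=(0,1_A)$. Accordingly, for a pointed category $\mathcal{C}$ with binary sums, $\mathcal{C}^{\mathrm{op}}$ is subtractive when for any object $A$ and any epimorphism $q:A+A\to Q$ in $\mathcal{C}$: if the morphisms $A+A\to A$ with components $1_A,1_A$ and with components $1_A,0$ both factor through $q$, then the morphism $A+A\to A$ with components $0,1_A$ factors through $q$. *)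

theory Defs
  imports "HOL-Algebra.Group"
begin

section \<open>Categories\<close>

record ('o, 'm) cat =
  Obj :: "'o set"
  Arr :: "'m set"
  Dom :: "'m \<Rightarrow> 'o"
  Cod :: "'m \<Rightarrow> 'o"
  Ident :: "'o \<Rightarrow> 'm"
  Comp :: "'m \<Rightarrow> 'm \<Rightarrow> 'm"  (infixl "\<cdot>\<index>" 70)

definition Hom :: "('o, 'm) cat \<Rightarrow> 'o \<Rightarrow> 'o \<Rightarrow> 'm set" where
  "Hom C A B = {f \<in> Arr C. Dom C f = A \<and> Cod C f = B}"

text \<open>Composition is written in the applicative order. It is constrained only on composable
  pairs; outside of these, and outside of the sets of objects and arrows, all operations of the
  record are arbitrary.\<close>

locale category =
  fixes C :: "('o, 'm) cat" (structure)
  assumes Dom_closed: "f \<in> Arr C \<Longrightarrow> Dom C f \<in> Obj C"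
    and Cod_closed: "f \<in> Arr C \<Longrightarrow> Cod C f \<in> Obj C"
    and Ident_closed: "A \<in> Obj C \<Longrightarrow> Ident C A \<in> Hom C A A"
    and Comp_closed: "f \<in> Hom C A B \<Longrightarrow> g \<in> Hom C B D \<Longrightarrow> g \<cdot> f \<in> Hom C A D"
    and Comp_Ident: "f \<in> Hom C A B \<Longrightarrow> f \<cdot> Ident C A = f"
    and Ident_Comp: "f \<in> Hom C A B \<Longrightarrow> Ident C B \<cdot> f = f"
    and Comp_assoc: "f \<in> Hom C A B \<Longrightarrow> g \<in> Hom C B D \<Longrightarrow> h \<in> Hom C D E
      \<Longrightarrow> (h \<cdot> g) \<cdot> f = h \<cdot> (g \<cdot> f)"

definition dual :: "('o, 'm) cat \<Rightarrow> ('o, 'm) cat" where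
  "dual C = \<lparr>Obj = Obj C, Arr = Arr C, Dom = Cod C, Cod = Dom C, Ident = Ident C,
     Comp = (\<lambda>g f. f \<cdot>\<^bsub>C\<^esub> g)\<rparr>"

definition monic :: "('o, 'm) cat \<Rightarrow> 'm \<Rightarrow> bool" where
  "monic C m \<longleftrightarrow> m \<in> Arr C \<and>
     (\<forall>X. \<forall>u \<in> Hom C X (Dom C m). \<forall>v \<in> Hom C X (Dom C m).
        m \<cdot>\<^bsub>C\<^esub> u = m \<cdot>\<^bsub>C\<^esub> v \<longrightarrow> u = v)"

definition epic :: "('o, 'm) cat \<Rightarrow> 'm \<Rightarrow> bool" where
  "epic C e \<longleftrightarrow> monic (dual C) e"


section \<open>Limits and colimits\<close>

definition is_functor ::
  "('i, 'a) cat \<Rightarrow> ('o, 'm) cat \<Rightarrow> ('i \<Rightarrow> 'o) \<Rightarrow> ('a \<Rightarrow> 'm) \<Rightarrow> bool" where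
  "is_functor J C Fo Fa \<longleftrightarrow>
     (\<forall>i \<in> Obj J. Fo i \<in> Obj C) \<and>
     (\<forall>a \<in> Arr J. Fa a \<in> Hom C (Fo (Dom J a)) (Fo (Cod J a))) \<and>
     (\<forall>i \<in> Obj J. Fa (Ident J i) = Ident C (Fo i)) \<and>
     (\<forall>a \<in> Arr J. \<forall>b \<in> Arr J. Cod J a = Dom J b \<longrightarrow> Fa (b \<cdot>\<^bsub>J\<^esub> a) = Fa b \<cdot>\<^bsub>C\<^esub> Fa a)"

definition is_cone ::
  "('i, 'a) cat \<Rightarrow> ('o, 'm) cat \<Rightarrow> ('i \<Rightarrow> 'o) \<Rightarrow> ('a \<Rightarrow> 'm) \<Rightarrow> 'o \<Rightarrow> ('i \<Rightarrow> 'm) \<Rightarrow> bool" where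
  "is_cone J C Fo Fa X \<mu> \<longleftrightarrow> X \<in> Obj C \<and>
     (\<forall>i \<in> Obj J. \<mu> i \<in> Hom C X (Fo i)) \<and>
     (\<forall>a \<in> Arr J. Fa a \<cdot>\<^bsub>C\<^esub> \<mu> (Dom J a) = \<mu> (Cod J a))"

definition is_limit ::
  "('i, 'a) cat \<Rightarrow> ('o, 'm) cat \<Rightarrow> ('i \<Rightarrow> 'o) \<Rightarrow> ('a \<Rightarrow> 'm) \<Rightarrow> 'o \<Rightarrow> ('i \<Rightarrow> 'm) \<Rightarrow> bool" where
  "is_limit J C Fo Fa L \<pi> \<longleftrightarrow> is_cone J C Fo Fa L \<pi> \<and>
     (\<forall>X \<mu>. is_cone J C Fo Fa X \<mu> \<longrightarrow>
        (\<exists>!u. u \<in> Hom C X L \<and> (\<forall>i \<in> Obj J. \<pi> i \<cdot>\<^bsub>C\<^esub> u = \<mu> i)))"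

text \<open>Every finite category is isomorphic to one whose objects and arrows are natural numbers,
  so that fixing the types of the index category is no restriction.\<close>

definition has_finite_limits :: "('o, 'm) cat \<Rightarrow> bool" where
  "has_finite_limits C \<longleftrightarrow>
     (\<forall>(J :: (nat, nat) cat) Fo Fa.
        category J \<and> finite (Obj J) \<and> finite (Arr J) \<and> is_functor J C Fo Fa \<longrightarrow>
        (\<exists>L \<pi>. is_limit J C Fo Fa L \<pi>))"

definition is_product :: "('o, 'm) cat \<Rightarrow> 'o \<Rightarrow> 'o \<Rightarrow> 'o \<Rightarrow> 'm \<Rightarrow> 'm \<Rightarrow> bool" where
  "is_product C A B P p q \<longleftrightarrow> p \<in> Hom C P A \<and> q \<in> Hom C P B \<and>
     (\<forall>X. \<forall>f \<in> Hom C X A. \<forall>g \<in> Hom C X B.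
        \<exists>!h. h \<in> Hom C X P \<and> p \<cdot>\<^bsub>C\<^esub> h = f \<and> q \<cdot>\<^bsub>C\<^esub> h = g)"

definition has_binary_products :: "('o, 'm) cat \<Rightarrow> bool" where
  "has_binary_products C \<longleftrightarrow> (\<forall>A \<in> Obj C. \<forall>B \<in> Obj C. \<exists>P p q. is_product C A B P p q)"

definition has_binary_coproducts :: "('o, 'm) cat \<Rightarrow> bool" where
  "has_binary_coproducts C \<longleftrightarrow> has_binary_products (dual C)"

text \<open>The morphism \<open>(f, g)\<close> into the product with projections \<open>p\<close> and \<open>q\<close>.\<close>

definition pairing :: "('o, 'm) cat \<Rightarrow> 'm \<Rightarrow> 'm \<Rightarrow> 'm \<Rightarrow> 'm \<Rightarrow> 'm" where
  "pairing C p q f g =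
     (THE h. h \<in> Hom C (Dom C f) (Dom C p) \<and> p \<cdot>\<^bsub>C\<^esub> h = f \<and> q \<cdot>\<^bsub>C\<^esub> h = g)"

definition is_pullback ::
  "('o, 'm) cat \<Rightarrow> 'm \<Rightarrow> 'm \<Rightarrow> 'o \<Rightarrow> 'm \<Rightarrow> 'm \<Rightarrow> bool" where
  "is_pullback C f g P p q \<longleftrightarrow>
     f \<in> Arr C \<and> g \<in> Arr C \<and> Cod C f = Cod C g \<and>
     p \<in> Hom C P (Dom C f) \<and> q \<in> Hom C P (Dom C g) \<and> f \<cdot>\<^bsub>C\<^esub> p = g \<cdot>\<^bsub>C\<^esub> q \<and>
     (\<forall>X. \<forall>u \<in> Hom C X (Dom C f). \<forall>v \<in> Hom C X (Dom C g).
        f \<cdot>\<^bsub>C\<^esub> u = g \<cdot>\<^bsub>C\<^esub> v \<longrightarrow>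
        (\<exists>!h. h \<in> Hom C X P \<and> p \<cdot>\<^bsub>C\<^esub> h = u \<and> q \<cdot>\<^bsub>C\<^esub> h = v))"

definition is_coequalizer :: "('o, 'm) cat \<Rightarrow> 'm \<Rightarrow> 'm \<Rightarrow> 'm \<Rightarrow> bool" where
  "is_coequalizer C f g e \<longleftrightarrow>
     f \<in> Arr C \<and> g \<in> Arr C \<and> Dom C f = Dom C g \<and> Cod C f = Cod C g \<and>
     e \<in> Arr C \<and> Dom C e = Cod C f \<and> e \<cdot>\<^bsub>C\<^esub> f = e \<cdot>\<^bsub>C\<^esub> g \<and>
     (\<forall>Z. \<forall>h \<in> Hom C (Cod C f) Z.
        h \<cdot>\<^bsub>C\<^esub> f = h \<cdot>\<^bsub>C\<^esub> g \<longrightarrow> (\<exists>!u. u \<in> Hom C (Cod C e) Z \<and> u \<cdot>\<^bsub>C\<^esub> e = h))"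


section \<open>Regular and Barr exact categories\<close>

definition regular_epi :: "('o, 'm) cat \<Rightarrow> 'm \<Rightarrow> bool" where
  "regular_epi C e \<longleftrightarrow> (\<exists>f g. is_coequalizer C f g e)"

definition is_kernel_pair :: "('o, 'm) cat \<Rightarrow> 'm \<Rightarrow> 'o \<Rightarrow> 'm \<Rightarrow> 'm \<Rightarrow> bool" where
  "is_kernel_pair C f R r\<^sub>1 r\<^sub>2 \<longleftrightarrow> is_pullback C f f R r\<^sub>1 r\<^sub>2"

definition regular_category :: "('o, 'm) cat \<Rightarrow> bool" where
  "regular_category C \<longleftrightarrow> category C \<and> has_finite_limits C \<and>
     (\<forall>f R r\<^sub>1 r\<^sub>2. is_kernel_pair C f R r\<^sub>1 r\<^sub>2 \<longrightarrow> (\<exists>e. is_coequalizer C r\<^sub>1 r\<^sub>2 e)) \<and>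
     (\<forall>e g P p q. regular_epi C e \<and> is_pullback C e g P p q \<longrightarrow> regular_epi C q)"

text \<open>An internal equivalence relation on \<open>X\<close>, given by the two components of
  \<open>R \<rightarrow> X \<times> X\<close>. Transitivity is expressed with the pullback of \<open>r\<^sub>2\<close> along \<open>r\<^sub>1\<close>, that is, with
  the object of composable pairs.\<close>

definition internal_equivalence ::
  "('o, 'm) cat \<Rightarrow> 'o \<Rightarrow> 'o \<Rightarrow> 'm \<Rightarrow> 'm \<Rightarrow> bool" where
  "internal_equivalence C X R r\<^sub>1 r\<^sub>2 \<longleftrightarrow>
     r\<^sub>1 \<in> Hom C R X \<and> r\<^sub>2 \<in> Hom C R X \<and>
     (\<forall>Y. \<forall>u \<in> Hom C Y R. \<forall>v \<in> Hom C Y R.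
        r\<^sub>1 \<cdot>\<^bsub>C\<^esub> u = r\<^sub>1 \<cdot>\<^bsub>C\<^esub> v \<and> r\<^sub>2 \<cdot>\<^bsub>C\<^esub> u = r\<^sub>2 \<cdot>\<^bsub>C\<^esub> v \<longrightarrow> u = v) \<and>
     (\<exists>d \<in> Hom C X R. r\<^sub>1 \<cdot>\<^bsub>C\<^esub> d = Ident C X \<and> r\<^sub>2 \<cdot>\<^bsub>C\<^esub> d = Ident C X) \<and>
     (\<exists>s \<in> Hom C R R. r\<^sub>1 \<cdot>\<^bsub>C\<^esub> s = r\<^sub>2 \<and> r\<^sub>2 \<cdot>\<^bsub>C\<^esub> s = r\<^sub>1) \<and>
     (\<forall>P p q. is_pullback C r\<^sub>2 r\<^sub>1 P p q \<longrightarrow>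
        (\<exists>t \<in> Hom C P R. r\<^sub>1 \<cdot>\<^bsub>C\<^esub> t = r\<^sub>1 \<cdot>\<^bsub>C\<^esub> p \<and> r\<^sub>2 \<cdot>\<^bsub>C\<^esub> t = r\<^sub>2 \<cdot>\<^bsub>C\<^esub> q))"

definition barr_exact :: "('o, 'm) cat \<Rightarrow> bool" where
  "barr_exact C \<longleftrightarrow> regular_category C \<and>
     (\<forall>X R r\<^sub>1 r\<^sub>2. internal_equivalence C X R r\<^sub>1 r\<^sub>2 \<longrightarrow> (\<exists>f. is_kernel_pair C f R r\<^sub>1 r\<^sub>2))"


section \<open>Pointed and subtractive categories\<close>

definition is_terminal :: "('o, 'm) cat \<Rightarrow> 'o \<Rightarrow> bool" where
  "is_terminal C T \<longleftrightarrow> T \<in> Obj C \<and> (\<forall>A \<in> Obj C. \<exists>!f. f \<in> Hom C A T)"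

definition is_initial :: "('o, 'm) cat \<Rightarrow> 'o \<Rightarrow> bool" where
  "is_initial C I \<longleftrightarrow> is_terminal (dual C) I"

definition is_zero_object :: "('o, 'm) cat \<Rightarrow> 'o \<Rightarrow> bool" where
  "is_zero_object C Z \<longleftrightarrow> is_terminal C Z \<and> is_initial C Z"

definition pointed :: "('o, 'm) cat \<Rightarrow> bool" where
  "pointed C \<longleftrightarrow> (\<exists>Z. is_zero_object C Z)"

definition zero_mor :: "('o, 'm) cat \<Rightarrow> 'o \<Rightarrow> 'o \<Rightarrow> 'm" where
  "zero_mor C A B =
     (THE f. \<exists>Z g h. is_zero_object C Z \<and> g \<in> Hom C A Z \<and> h \<in> Hom C Z B \<and> f = h \<cdot>\<^bsub>C\<^esub> g)"

definition subtractive :: "('o, 'm) cat \<Rightarrow> bool" where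
  "subtractive C \<longleftrightarrow> category C \<and> pointed C \<and> has_binary_products C \<and>
     (\<forall>A P p q R r.
        is_product C A A P p q \<and> monic C r \<and> r \<in> Hom C R P \<and>
        (\<exists>f\<^sub>1 \<in> Hom C A R. r \<cdot>\<^bsub>C\<^esub> f\<^sub>1 = pairing C p q (Ident C A) (Ident C A)) \<and>
        (\<exists>f\<^sub>2 \<in> Hom C A R. r \<cdot>\<^bsub>C\<^esub> f\<^sub>2 = pairing C p q (Ident C A) (zero_mor C A A)) \<longrightarrow>
        (\<exists>f\<^sub>3 \<in> Hom C A R. r \<cdot>\<^bsub>C\<^esub> f\<^sub>3 = pairing C p q (zero_mor C A A) (Ident C A)))"


section \<open>Abelian categories\<close>

text \<open>An enrichment in abelian groups: \<open>G A B\<close> is the group structure on \<open>Hom C A B\<close>, in the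
  multiplicative notation of \<^theory>\<open>HOL-Algebra.Group\<close>.\<close>

definition ab_enrichment :: "('o, 'm) cat \<Rightarrow> ('o \<Rightarrow> 'o \<Rightarrow> 'm monoid) \<Rightarrow> bool" where
  "ab_enrichment C G \<longleftrightarrow>
     (\<forall>A \<in> Obj C. \<forall>B \<in> Obj C. carrier (G A B) = Hom C A B \<and> comm_group (G A B)) \<and>
     (\<forall>A \<in> Obj C. \<forall>B \<in> Obj C. \<forall>D \<in> Obj C.
        \<forall>f \<in> Hom C A B. \<forall>f' \<in> Hom C A B. \<forall>g \<in> Hom C B D. \<forall>g' \<in> Hom C B D.
          g \<cdot>\<^bsub>C\<^esub> (f \<otimes>\<^bsub>G A B\<^esub> f') = (g \<cdot>\<^bsub>C\<^esub> f) \<otimes>\<^bsub>G A D\<^esub> (g \<cdot>\<^bsub>C\<^esub> f') \<and>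
          (g \<otimes>\<^bsub>G B D\<^esub> g') \<cdot>\<^bsub>C\<^esub> f = (g \<cdot>\<^bsub>C\<^esub> f) \<otimes>\<^bsub>G A D\<^esub> (g' \<cdot>\<^bsub>C\<^esub> f))"

definition is_biproduct ::
  "('o, 'm) cat \<Rightarrow> ('o \<Rightarrow> 'o \<Rightarrow> 'm monoid) \<Rightarrow> 'o \<Rightarrow> 'o \<Rightarrow> 'o \<Rightarrow> 'm \<Rightarrow> 'm \<Rightarrow> 'm \<Rightarrow> 'm \<Rightarrow> bool" where
  "is_biproduct C G A B S p\<^sub>1 p\<^sub>2 i\<^sub>1 i\<^sub>2 \<longleftrightarrow>
     p\<^sub>1 \<in> Hom C S A \<and> p\<^sub>2 \<in> Hom C S B \<and> i\<^sub>1 \<in> Hom C A S \<and> i\<^sub>2 \<in> Hom C B S \<and>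
     p\<^sub>1 \<cdot>\<^bsub>C\<^esub> i\<^sub>1 = Ident C A \<and> p\<^sub>2 \<cdot>\<^bsub>C\<^esub> i\<^sub>2 = Ident C B \<and>
     (i\<^sub>1 \<cdot>\<^bsub>C\<^esub> p\<^sub>1) \<otimes>\<^bsub>G S S\<^esub> (i\<^sub>2 \<cdot>\<^bsub>C\<^esub> p\<^sub>2) = Ident C S"

definition additive_category :: "('o, 'm) cat \<Rightarrow> bool" where
  "additive_category C \<longleftrightarrow> category C \<and> pointed C \<and>
     (\<exists>G. ab_enrichment C G \<and>
        (\<forall>A \<in> Obj C. \<forall>B \<in> Obj C. \<exists>S p\<^sub>1 p\<^sub>2 i\<^sub>1 i\<^sub>2. is_biproduct C G A B S p\<^sub>1 p\<^sub>2 i\<^sub>1 i\<^sub>2))"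

definition is_kernel :: "('o, 'm) cat \<Rightarrow> 'm \<Rightarrow> 'm \<Rightarrow> bool" where
  "is_kernel C f k \<longleftrightarrow> f \<in> Arr C \<and> k \<in> Arr C \<and> Cod C k = Dom C f \<and>
     f \<cdot>\<^bsub>C\<^esub> k = zero_mor C (Dom C k) (Cod C f) \<and>
     (\<forall>X. \<forall>g \<in> Hom C X (Dom C f). f \<cdot>\<^bsub>C\<^esub> g = zero_mor C X (Cod C f) \<longrightarrow>
        (\<exists>!u. u \<in> Hom C X (Dom C k) \<and> k \<cdot>\<^bsub>C\<^esub> u = g))"

definition is_cokernel :: "('o, 'm) cat \<Rightarrow> 'm \<Rightarrow> 'm \<Rightarrow> bool" where
  "is_cokernel C f c \<longleftrightarrow> is_kernel (dual C) f c"

definition abelian_category :: "('o, 'm) cat \<Rightarrow> bool" where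
  "abelian_category C \<longleftrightarrow> additive_category C \<and>
     (\<forall>f \<in> Arr C. \<exists>k. is_kernel C f k) \<and>
     (\<forall>f \<in> Arr C. \<exists>c. is_cokernel C f c) \<and>
     (\<forall>m. monic C m \<longrightarrow> (\<exists>f. is_kernel C f m)) \<and>
     (\<forall>e. epic C e \<longrightarrow> (\<exists>f. is_cokernel C f e))"


section \<open>Well-definedness and duality\<close>

lemma dual_dual: "dual (dual C) = C"
  by (simp add: dual_def)

lemma Hom_dual: "Hom (dual C) A B = Hom C B A"
  by (auto simp: Hom_def dual_def)

lemma category_dual:
  assumes "category C"
  shows "category (dual C)"
proof -
  interpret category C by fact
  have sel: "Obj (dual C) = Obj C" "Arr (dual C) = Arr C" "Dom (dual C) = Cod C"
    "Cod (dual C) = Dom C" "Ident (dual C) = Ident C" "g \<cdot>\<^bsub>dual C\<^esub> f = f \<cdot>\<^bsub>C\<^esub> g" for f g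
    by (simp_all add: dual_def)
  show ?thesis
    by (rule category.intro; unfold sel Hom_dual)
      (auto intro: Dom_closed Cod_closed Ident_closed Comp_closed Comp_Ident Ident_Comp
        Comp_assoc[symmetric])
qed

lemma is_zero_object_dual: "is_zero_object (dual C) Z \<longleftrightarrow> is_zero_object C Z"
  by (auto simp: is_zero_object_def is_initial_def dual_dual)

lemma zero_mor_dual: "zero_mor (dual C) A B = zero_mor C B A"
  by (simp add: zero_mor_def is_zero_object_dual Hom_dual)
    (rule arg_cong[where f = The], auto simp: dual_def fun_eq_iff)

lemma zero_mor_eqI:
  assumes "category C" and Z: "is_zero_object C Z" "g \<in> Hom C A Z" "h \<in> Hom C Z B"
  shows "zero_mor C A B = h \<cdot>\<^bsub>C\<^esub> g"
proof -
  interpret category C by fact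
  have "h' \<cdot>\<^bsub>C\<^esub> g' = h \<cdot>\<^bsub>C\<^esub> g"
    if Z': "is_zero_object C Z'" "g' \<in> Hom C A Z'" "h' \<in> Hom C Z' B" for Z' g' h'
  proof -
    have "Z \<in> Obj C" "Z' \<in> Obj C"
      using Z Z' by (auto simp: is_zero_object_def is_terminal_def)
    then obtain t where t: "t \<in> Hom C Z' Z"
      using Z by (auto simp: is_zero_object_def is_terminal_def)
    have objs: "A \<in> Obj C" "B \<in> Obj C"
      using Z by (auto simp: Hom_def intro: Dom_closed Cod_closed)
    have "t \<cdot>\<^bsub>C\<^esub> g' \<in> Hom C A Z"
      using Z' t by (blast intro: Comp_closed)
    then have g: "t \<cdot>\<^bsub>C\<^esub> g' = g"
      using Z objs by (auto simp: is_zero_object_def is_terminal_def)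
    have "h \<cdot>\<^bsub>C\<^esub> t \<in> Hom C Z' B"
      using Z t by (blast intro: Comp_closed)
    moreover have "\<exists>!k. k \<in> Hom C Z' B"
      using Z'(1) objs by (simp add: is_zero_object_def is_initial_def is_terminal_def Hom_dual)
        (simp add: dual_def)
    ultimately have h: "h \<cdot>\<^bsub>C\<^esub> t = h'"
      using Z' by blast
    show ?thesis
      using Comp_assoc[OF Z'(2) t Z(3)] g h by simp
  qed
  then show ?thesis
    unfolding zero_mor_def using Z by (intro the_equality) blast+
qed

lemma pairing_eqI:
  assumes "is_product C A B P p q" "h \<in> Hom C X P" "p \<cdot>\<^bsub>C\<^esub> h = f" "q \<cdot>\<^bsub>C\<^esub> h = g"
    and "f \<in> Hom C X A" "g \<in> Hom C X B"
  shows "pairing C p q f g = h"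
proof -
  have "Dom C f = X" "Dom C p = P"
    using assms by (auto simp: is_product_def Hom_def)
  moreover have "\<exists>!h. h \<in> Hom C X P \<and> p \<cdot>\<^bsub>C\<^esub> h = f \<and> q \<cdot>\<^bsub>C\<^esub> h = g"
    using assms by (auto simp: is_product_def)
  ultimately show ?thesis
    unfolding pairing_def using assms by (auto intro: the1_equality)
qed

end

(* Subtractivity yields no subtraction morphism on an object A, but for regular C and with
   subtractivity of the dual it yields one on a regular cover p of A. The two hypotheses meet in
   the image R of the morphism A + A -> A x A with rows (1, 1) and (1, 0), which is both a
   subobject of A x A and a quotient of A + A. The locally defined subtractions suffice to prove
   that the canonical projections make the sum A + B a product: the universal property is
   verified on the cover and then descends along p. So every hom-set is a commutative monoid, and
   the local negatives also descend, which makes C additive.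
   In an exact additive category a monomorphism m : M -> A is the kernel of the quotient by the
   equivalence relation M + A, the congruence modulo M; this also gives cokernels. An epimorphism
   with image m then has m invertible, so it is the coequalizer of its kernel pair (a, b) and
   the cokernel of a - b.
   Conversely, additivity is self-dual, and in an additive category f_3 = f_1 - f_2 witnesses
   subtractivity. *)
theory Submission
  imports Defs
begin

section \<open>Regular categories\<close>

text \<open>The matrix with rows (1, 1) and (1, 0) is symmetric: its columns, as morphisms into A x
  A, are the two that subtractivity starts from, and its rows, as morphisms out of A + A, are the
  two that the dual condition starts from. Hence R receives a morphism s over (0, 1) and carries a
  morphism \<sigma> under (0, 1). The obstacle is that s lands in R and not in A + A; it lifts along
  the quotient map only after a change of domain, and this is the origin of the cover p. Since R is
  a subobject, equations of morphisms into it are checked on two components, and \<sigma> then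
  carries them over to A. The outcome is a term condition that takes the place of linearity: a term
  that vanishes whenever its second argument is 0 does not depend on its first argument. Together
  with the local subtraction it shows that the projections of A + B are jointly monic, and joint
  monicity is what lets morphisms into the sum descend along covers.\<close>

context category
begin

text \<open>Here and in the next facts \<open>Hom\<close> is traded for \<open>Arr\<close>,
  \<open>Dom\<close> and \<open>Cod\<close>, so that composability becomes a condition settled by
  computing domains and codomains.\<close>

lemma comp_arr [simp]:
  assumes "f \<in> Arr C" "g \<in> Arr C" "Cod C f = Dom C g"
  shows "g \<cdot> f \<in> Arr C" "Dom C (g \<cdot> f) = Dom C f" "Cod C (g \<cdot> f) = Cod C g"
  using Comp_closed[of f "Dom C f" "Dom C g" g "Cod C g"] assms by (auto simp: Hom_def)

lemma comp_assoc [simp]: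
  assumes "f \<in> Arr C" "g \<in> Arr C" "h \<in> Arr C" "Cod C f = Dom C g" "Cod C g = Dom C h"
  shows "(h \<cdot> g) \<cdot> f = h \<cdot> (g \<cdot> f)"
  using Comp_assoc[of f "Dom C f" "Dom C g" g "Dom C h" h "Cod C h"] assms by (auto simp: Hom_def)

text \<open>Composites are normalised to nest to the right, where an equation for
  \<open>g \<cdot> f\<close> no longer matches inside a longer composite. This form restores the
  match.\<close>

lemma comp_fold:
  assumes "g \<cdot> f = h" "f \<in> Arr C" "g \<in> Arr C" "x \<in> Arr C" "Cod C x = Dom C f" "Cod C f = Dom C g"
  shows "g \<cdot> (f \<cdot> x) = h \<cdot> x"
  using assms by (metis comp_assoc)

lemma ident_arr [simp]:
  assumes "A \<in> Obj C"
  shows "Ident C A \<in> Arr C" "Dom C (Ident C A) = A" "Cod C (Ident C A) = A"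
  using Ident_closed[OF assms] by (auto simp: Hom_def)

lemma comp_ident [simp]: "f \<in> Arr C \<Longrightarrow> Dom C f = A \<Longrightarrow> f \<cdot> Ident C A = f"
  using Comp_Ident by (auto simp: Hom_def)

lemma ident_comp [simp]: "f \<in> Arr C \<Longrightarrow> Cod C f = A \<Longrightarrow> Ident C A \<cdot> f = f"
  using Ident_Comp by (auto simp: Hom_def)

lemma dom_obj [simp]: "f \<in> Arr C \<Longrightarrow> Dom C f \<in> Obj C"
  and cod_obj [simp]: "f \<in> Arr C \<Longrightarrow> Cod C f \<in> Obj C"
  by (auto intro: Dom_closed Cod_closed)

lemma dual_simps [simp]:
  "Obj (dual C) = Obj C" "Arr (dual C) = Arr C" "Dom (dual C) = Cod C" "Cod (dual C) = Dom C"
  "Ident (dual C) = Ident C" "g \<cdot>\<^bsub>dual C\<^esub> f = f \<cdot> g"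
  by (simp_all add: dual_def)

section \<open>Monomorphisms, epimorphisms and coequalizers\<close>

lemma monicD:
  assumes "monic C m" "u \<in> Arr C" "v \<in> Arr C" "Dom C u = Dom C v" "Cod C u = Dom C m" "Cod C v = Dom C m"
    and "m \<cdot> u = m \<cdot> v"
  shows "u = v"
  using assms by (auto simp: monic_def Hom_def)

lemma epic_iff:
  "epic C e \<longleftrightarrow> e \<in> Arr C \<and>
     (\<forall>X. \<forall>u \<in> Hom C (Cod C e) X. \<forall>v \<in> Hom C (Cod C e) X. u \<cdot> e = v \<cdot> e \<longrightarrow> u = v)"
  by (simp add: epic_def monic_def Hom_dual)

lemma epicD:
  assumes "epic C e" "u \<in> Arr C" "v \<in> Arr C" "Dom C u = Cod C e" "Dom C v = Cod C e" "Cod C u = Cod C v"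
    and "u \<cdot> e = v \<cdot> e"
  shows "u = v"
  using assms by (auto simp: epic_iff Hom_def)

lemma coequalizer_factor:
  assumes "is_coequalizer C f g e" "h \<in> Arr C" "Dom C h = Cod C f" "h \<cdot> f = h \<cdot> g"
  obtains u where "u \<in> Arr C" "Dom C u = Cod C e" "Cod C u = Cod C h" "u \<cdot> e = h"
proof -
  have "h \<in> Hom C (Cod C f) (Cod C h)"
    using assms by (auto simp: Hom_def)
  then have "\<exists>!u. u \<in> Hom C (Cod C e) (Cod C h) \<and> u \<cdot> e = h"
    using assms(1,4) by (simp add: is_coequalizer_def)
  then show thesis
    using that by (auto simp: Hom_def)
qed

lemma coequalizer_epic:
  assumes "is_coequalizer C f g e"
  shows "epic C e"
proof -
  have e: "f \<in> Arr C" "g \<in> Arr C" "e \<in> Arr C" "Dom C e = Cod C f" "Dom C e = Cod C g"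
    "Dom C f = Dom C g" "e \<cdot> f = e \<cdot> g"
    using assms by (auto simp: is_coequalizer_def)
  have "u = v" if uv: "u \<in> Hom C (Cod C e) X" "v \<in> Hom C (Cod C e) X" "u \<cdot> e = v \<cdot> e" for X u v
  proof -
    have "u \<cdot> e \<in> Hom C (Cod C f) X" "(u \<cdot> e) \<cdot> f = (u \<cdot> e) \<cdot> g"
      using e uv by (auto simp: Hom_def)
    then have "\<exists>!w. w \<in> Hom C (Cod C e) X \<and> w \<cdot> e = u \<cdot> e"
      using assms unfolding is_coequalizer_def by blast
    then show "u = v"
      using uv by metis
  qed
  then show ?thesis
    using e by (auto simp: epic_iff)
qed

lemma regular_epi_epic: "regular_epi C e \<Longrightarrow> epic C e"
  using coequalizer_epic by (auto simp: regular_epi_def)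

lemma epic_comp:
  assumes "epic C e" "epic C e'" "Cod C e = Dom C e'"
  shows "epic C (e' \<cdot> e)"
proof -
  have "e \<in> Arr C" "e' \<in> Arr C"
    using assms by (auto simp: epic_iff)
  then show ?thesis
    using assms by (auto simp: epic_iff Hom_def)
qed

text \<open>The pair that \<open>e\<close> coequalizes is hidden by \<open>regular_epi\<close>; it
  suffices that \<open>h\<close> identifies all that \<open>e\<close> identifies. This is the
  descent principle along a cover.\<close>

lemma regular_epi_factor:
  assumes "regular_epi C e" "h \<in> Arr C" "Dom C h = Dom C e"
    and "\<And>a b. a \<in> Arr C \<Longrightarrow> b \<in> Arr C \<Longrightarrow> Dom C a = Dom C b \<Longrightarrow> Cod C a = Dom C e \<Longrightarrow>
      Cod C b = Dom C e \<Longrightarrow> e \<cdot> a = e \<cdot> b \<Longrightarrow> h \<cdot> a = h \<cdot> b"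
  obtains u where "u \<in> Arr C" "Dom C u = Cod C e" "Cod C u = Cod C h" "u \<cdot> e = h"
proof -
  obtain f g where fg: "is_coequalizer C f g e"
    using assms(1) by (auto simp: regular_epi_def)
  then have "f \<in> Arr C" "g \<in> Arr C" "Dom C f = Dom C g" "Cod C f = Dom C e" "Cod C g = Dom C e"
    "e \<cdot> f = e \<cdot> g"
    by (auto simp: is_coequalizer_def)
  then show thesis
    using coequalizer_factor[OF fg assms(2)] assms(3) assms(4)[of f g] that by metis
qed

section \<open>Pullbacks and images\<close>

lemma pullback_exists:
  assumes "has_finite_limits C" "f \<in> Arr C" "g \<in> Arr C" "Cod C f = Cod C g"
  obtains P p q where "is_pullback C f g P p q"
proof -
  \<comment> \<open>The shape of a cospan: the arrows 0, 1, 2 are the identities, 3 goes from 0 to 2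
    and 4 from 1 to 2. Of two composable arrows one is an identity, so the composite is the other
    one.\<close>
  define J :: "(nat, nat) cat" where
    "J = \<lparr>Obj = {0, 1, 2}, Arr = {0, 1, 2, 3, 4},
       Dom = (\<lambda>a. if a = 3 then 0 else if a = 4 then 1 else a),
       Cod = (\<lambda>a. if a < 3 then a else 2), Ident = (\<lambda>i. i),
       Comp = (\<lambda>b a. if a < 3 then b else a)\<rparr>"
  define Fo :: "nat \<Rightarrow> 'o" where
    "Fo = (\<lambda>i. if i = 0 then Dom C f else if i = 1 then Dom C g else Cod C f)"
  define Fa :: "nat \<Rightarrow> 'm" where
    "Fa = (\<lambda>a. if a = 3 then f else if a = 4 then g else Ident C (Fo a))"
  have "category J"
    by unfold_locales (auto simp: J_def Hom_def)
  moreover have "finite (Obj J)" "finite (Arr J)"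
    by (simp_all add: J_def)
  moreover have "is_functor J C Fo Fa"
    unfolding is_functor_def using assms(2-4) by (auto simp: J_def Fa_def Fo_def Hom_def)
  ultimately obtain L \<pi> where L: "is_limit J C Fo Fa L \<pi>"
    using assms(1) unfolding has_finite_limits_def by blast
  then have cone: "is_cone J C Fo Fa L \<pi>"
    by (simp add: is_limit_def)
  then have pi: "\<pi> 0 \<in> Hom C L (Dom C f)" "\<pi> 1 \<in> Hom C L (Dom C g)"
    "f \<cdot> \<pi> 0 = \<pi> 2" "g \<cdot> \<pi> 1 = \<pi> 2"
    by (auto simp: is_cone_def J_def Fo_def Fa_def)
  have "\<exists>!h. h \<in> Hom C X L \<and> \<pi> 0 \<cdot> h = u \<and> \<pi> 1 \<cdot> h = v"
    if uv: "u \<in> Hom C X (Dom C f)" "v \<in> Hom C X (Dom C g)" "f \<cdot> u = g \<cdot> v" for X u v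
  proof -
    define \<mu> where "\<mu> = (\<lambda>i::nat. if i = 0 then u else if i = 1 then v else f \<cdot> u)"
    have "is_cone J C Fo Fa X \<mu>"
      unfolding is_cone_def using uv assms(2-4) 
      by (auto simp: J_def Fo_def Fa_def \<mu>_def Hom_def)
    then have ex1: "\<exists>!h. h \<in> Hom C X L \<and> (\<forall>i \<in> Obj J. \<pi> i \<cdot> h = \<mu> i)"
      using L unfolding is_limit_def by blast
    have "(\<forall>i \<in> Obj J. \<pi> i \<cdot> h = \<mu> i) \<longleftrightarrow> \<pi> 0 \<cdot> h = u \<and> \<pi> 1 \<cdot> h = v"
      if h: "h \<in> Hom C X L" for h
    proof -
      \<comment> \<open>The leg to the corner 2 is determined by the leg to 0, so two legs describe
        the cone.\<close>
      have "\<pi> 2 \<cdot> h = f \<cdot> (\<pi> 0 \<cdot> h)"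
        using pi h assms(2) by (auto simp: Hom_def simp flip: pi(3))
      then show ?thesis
        by (auto simp: J_def \<mu>_def)
    qed
    then show ?thesis
      using ex1 by (metis (no_types, lifting))
  qed
  then show thesis
    using that[of L "\<pi> 0" "\<pi> 1"] assms(2-4) pi by (simp add: is_pullback_def)
qed

lemma pullback_arr:
  assumes "is_pullback C f g P p q"
  shows "f \<in> Arr C" "g \<in> Arr C" "Cod C g = Cod C f" "p \<in> Arr C" "q \<in> Arr C"
    "Dom C p = P" "Dom C q = P" "Cod C p = Dom C f" "Cod C q = Dom C g" "f \<cdot> p = g \<cdot> q"
  using assms by (auto simp: is_pullback_def Hom_def)

lemma pullback_factor:
  assumes "is_pullback C f g P p q" "u \<in> Arr C" "v \<in> Arr C" "Dom C u = Dom C v"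
    and "Cod C u = Dom C f" "Cod C v = Dom C g" "f \<cdot> u = g \<cdot> v"
  obtains h where "h \<in> Arr C" "Dom C h = Dom C u" "Cod C h = P" "p \<cdot> h = u" "q \<cdot> h = v"
proof -
  have "u \<in> Hom C (Dom C u) (Dom C f)" "v \<in> Hom C (Dom C u) (Dom C g)"
    using assms by (auto simp: Hom_def)
  then have "\<exists>h. h \<in> Hom C (Dom C u) P \<and> p \<cdot> h = u \<and> q \<cdot> h = v"
    using assms(1,7) unfolding is_pullback_def by blast
  then show thesis
    using that by (auto simp: Hom_def)
qed

lemma pullback_ext:
  assumes P: "is_pullback C f g P p q" and u: "u \<in> Arr C" "Cod C u = P" and v: "v \<in> Arr C" "Cod C v = P"
    and "Dom C u = Dom C v" "p \<cdot> u = p \<cdot> v" "q \<cdot> u = q \<cdot> v"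
  shows "u = v"
proof -
  note pq = pullback_arr[OF P]
  have "p \<cdot> v \<in> Hom C (Dom C v) (Dom C f)" "q \<cdot> v \<in> Hom C (Dom C v) (Dom C g)"
    "f \<cdot> (p \<cdot> v) = g \<cdot> (q \<cdot> v)"
    using pq v comp_fold[OF pq(10), of v] by (auto simp: Hom_def)
  then have "\<exists>!h. h \<in> Hom C (Dom C v) P \<and> p \<cdot> h = p \<cdot> v \<and> q \<cdot> h = q \<cdot> v"
    using P unfolding is_pullback_def by blast
  then show ?thesis
    using u v assms(6-8) by (auto simp: Hom_def)
qed

text \<open>Stability under pullback in the language of elements: an element \<open>u\<close> of the
  codomain of \<open>e\<close> acquires a preimage \<open>x\<close> after a change of domain along
  the cover \<open>z\<close>.\<close>

lemma regular_epi_lift: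
  assumes "regular_category C" "regular_epi C e" "u \<in> Arr C" "Cod C u = Cod C e"
  obtains z x where "regular_epi C z" "z \<in> Arr C" "x \<in> Arr C" "Dom C x = Dom C z"
    "Cod C z = Dom C u" "Cod C x = Dom C e" "e \<cdot> x = u \<cdot> z"
proof -
  have "e \<in> Arr C"
    using assms(2) by (auto simp: regular_epi_def is_coequalizer_def)
  then obtain P x z where P: "is_pullback C e u P x z"
    using pullback_exists assms by (metis regular_category_def)
  then have "regular_epi C z"
    using assms(1,2) unfolding regular_category_def by blast
  then show thesis
    using that pullback_arr[OF P] by auto
qed

text \<open>Two elements with equal images under \<open>r\<close> have preimages under
  \<open>q\<close> on a common cover; these form an element of the kernel pair of \<open>h\<close>,
  so \<open>q\<close> identifies them. Hence \<open>r\<close> is monic. The kernel pair is part of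
  the conclusion for the sake of \<open>epic_cokernel\<close>.\<close>

lemma image_factorization:
  assumes reg: "regular_category C" and h: "h \<in> Arr C"
  obtains a b q r where "is_coequalizer C a b q" "is_kernel_pair C h (Dom C a) a b" "monic C r"
    "q \<in> Arr C" "r \<in> Arr C" "Dom C q = Dom C h" "Cod C q = Dom C r" "Cod C r = Cod C h" "h = r \<cdot> q"
proof -
  obtain K a b where K: "is_pullback C h h K a b"
    using pullback_exists[of h h] reg h by (auto simp: regular_category_def)
  note ab = pullback_arr[OF K]
  obtain q where q: "is_coequalizer C a b q"
    using reg K unfolding regular_category_def is_kernel_pair_def by blast
  then have q': "q \<in> Arr C" "Dom C q = Dom C h" "q \<cdot> a = q \<cdot> b"
    using ab by (auto simp: is_coequalizer_def)
  have q_reg: "regular_epi C q"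
    using q by (auto simp: regular_epi_def)
  obtain r where r: "r \<in> Arr C" "Dom C r = Cod C q" "Cod C r = Cod C h" "r \<cdot> q = h"
    using coequalizer_factor[OF q, of h] ab h by metis
  have "u = v" if uv: "u \<in> Hom C X (Dom C r)" "v \<in> Hom C X (Dom C r)" "r \<cdot> u = r \<cdot> v" for X u v
  proof -
    have u: "u \<in> Arr C" "Dom C u = X" "Cod C u = Cod C q"
      and v: "v \<in> Arr C" "Dom C v = X" "Cod C v = Cod C q"
      using uv r by (auto simp: Hom_def)
    obtain z x where zx: "regular_epi C z" "z \<in> Arr C" "x \<in> Arr C" "Dom C x = Dom C z"
      "Cod C z = X" "Cod C x = Dom C q" "q \<cdot> x = u \<cdot> z"
      using regular_epi_lift[OF reg q_reg u(1,3)] u by metis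
    \<comment> \<open>The second lift starts from \<open>v \<cdot> z\<close>, so that both preimages
      live on \<open>Dom C z'\<close>.\<close>
    obtain z' x' where zx': "regular_epi C z'" "z' \<in> Arr C" "x' \<in> Arr C" "Dom C x' = Dom C z'"
      "Cod C z' = Dom C z" "Cod C x' = Dom C q" "q \<cdot> x' = (v \<cdot> z) \<cdot> z'"
      using regular_epi_lift[OF reg q_reg, of "v \<cdot> z"] v zx by auto
    have "h \<cdot> (x \<cdot> z') = (r \<cdot> u) \<cdot> (z \<cdot> z')"
      using zx(1-6) zx'(1-6) u r(1-3) q'(1,2)
      by (simp add: comp_fold[OF r(4), symmetric] comp_fold[OF zx(7)])
    also have "\<dots> = h \<cdot> x'"
      unfolding uv(3) using zx(1-6) zx' v r(1-3) q'(1,2)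
      by (simp add: comp_fold[OF r(4), symmetric])
    finally have "h \<cdot> (x \<cdot> z') = h \<cdot> x'" .
    then obtain k where "k \<in> Arr C" "Cod C k = K" "a \<cdot> k = x \<cdot> z'" "b \<cdot> k = x'"
      using pullback_factor[OF K, of "x \<cdot> z'" x'] zx(2-6) zx'(2-6) q'(2) by auto
    then have "q \<cdot> (x \<cdot> z') = q \<cdot> x'"
      using q' ab by (metis comp_assoc)
    then have "u \<cdot> (z \<cdot> z') = v \<cdot> (z \<cdot> z')"
      using zx(1-6) zx' u v q' by (simp add: comp_fold[OF zx(7)])
    moreover have "epic C (z \<cdot> z')"
      using zx zx' by (auto intro: epic_comp regular_epi_epic)
    ultimately show "u = v"
      using epicD[of "z \<cdot> z'" u v] zx zx' u v by auto
  qed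
  then have "monic C r"
    using r(1) by (auto simp: monic_def)
  moreover have "is_kernel_pair C h (Dom C a) a b"
    using K ab(6) by (simp add: is_kernel_pair_def)
  ultimately show thesis
    using that[OF q] q'(1,2) r by metis
qed

end

section \<open>Pointed categories with sums\<close>

locale pointed_category = category C for C :: "('o, 'm) cat" (structure) +
  assumes pointed: "pointed C"
begin

abbreviation null :: "'o \<Rightarrow> 'o \<Rightarrow> 'm" where
  "null \<equiv> zero_mor C"

lemma null_factor:
  assumes "A \<in> Obj C" "B \<in> Obj C"
  obtains Z g h where "is_zero_object C Z" "g \<in> Arr C" "Dom C g = A" "Cod C g = Z"
    "h \<in> Arr C" "Dom C h = Z" "Cod C h = B"
proof -
  obtain Z where Z: "is_zero_object C Z"
    using pointed by (auto simp: pointed_def)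
  have "\<exists>g. g \<in> Hom C A Z" "\<exists>h. h \<in> Hom C Z B"
    using Z assms by (auto simp: is_zero_object_def is_initial_def is_terminal_def Hom_dual)
  then show thesis
    using that[OF Z] by (auto simp: Hom_def)
qed

lemma null_eqI:
  assumes "is_zero_object C Z" "g \<in> Arr C" "Cod C g = Z" "h \<in> Arr C" "Dom C h = Z"
  shows "null (Dom C g) (Cod C h) = h \<cdot> g"
  by (rule zero_mor_eqI[OF category_axioms assms(1)]) (use assms in \<open>auto simp: Hom_def\<close>)

lemma null_arr [simp]:
  assumes "A \<in> Obj C" "B \<in> Obj C"
  shows "null A B \<in> Arr C" "Dom C (null A B) = A" "Cod C (null A B) = B"
proof -
  obtain Z g h where gh: "is_zero_object C Z" "g \<in> Arr C" "Dom C g = A" "Cod C g = Z"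
    "h \<in> Arr C" "Dom C h = Z" "Cod C h = B"
    using null_factor[OF assms] by metis
  then have "null A B = h \<cdot> g"
    using null_eqI[of Z g h] by simp
  then show "null A B \<in> Arr C" "Dom C (null A B) = A" "Cod C (null A B) = B"
    using gh by auto
qed

lemma comp_null [simp]:
  assumes "A \<in> Obj C" "f \<in> Arr C" "Dom C f = B"
  shows "f \<cdot> null A B = null A (Cod C f)"
proof -
  obtain Z g h where gh: "is_zero_object C Z" "g \<in> Arr C" "Dom C g = A" "Cod C g = Z"
    "h \<in> Arr C" "Dom C h = Z" "Cod C h = B"
    using null_factor[of A B] assms by (metis dom_obj)
  then show ?thesis
    using null_eqI[of Z g h] null_eqI[of Z g "f \<cdot> h"] assms by simp
qed

lemma null_comp [simp]:
  assumes "B \<in> Obj C" "f \<in> Arr C" "Cod C f = A"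
  shows "null A B \<cdot> f = null (Dom C f) B"
proof -
  obtain Z g h where gh: "is_zero_object C Z" "g \<in> Arr C" "Dom C g = A" "Cod C g = Z"
    "h \<in> Arr C" "Dom C h = Z" "Cod C h = B"
    using null_factor[of A B] assms by (metis cod_obj)
  then show ?thesis
    using null_eqI[of Z g h] null_eqI[of Z "g \<cdot> f" h] assms by simp
qed

section \<open>Kernels and cokernels\<close>

lemma is_kernelI:
  assumes "f \<in> Arr C" "k \<in> Arr C" "Cod C k = Dom C f" "f \<cdot> k = null (Dom C k) (Cod C f)" "monic C k"
    and "\<And>g. g \<in> Arr C \<Longrightarrow> Cod C g = Dom C f \<Longrightarrow> f \<cdot> g = null (Dom C g) (Cod C f) \<Longrightarrow>
      \<exists>u \<in> Arr C. Dom C u = Dom C g \<and> Cod C u = Dom C k \<and> k \<cdot> u = g"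
  shows "is_kernel C f k"
proof -
  have "\<exists>!u. u \<in> Hom C X (Dom C k) \<and> k \<cdot> u = g"
    if "g \<in> Hom C X (Dom C f)" "f \<cdot> g = null X (Cod C f)" for X g
  proof (rule ex_ex1I)
    show "\<exists>u. u \<in> Hom C X (Dom C k) \<and> k \<cdot> u = g"
      using assms(6)[of g] that by (auto simp: Hom_def)
    show "u = v" if "u \<in> Hom C X (Dom C k) \<and> k \<cdot> u = g" "v \<in> Hom C X (Dom C k) \<and> k \<cdot> v = g" for u v
      using monicD[OF assms(5), of u v] that by (auto simp: Hom_def)
  qed
  then show ?thesis
    using assms(1-4) by (simp add: is_kernel_def)
qed

lemma is_cokernelI:
  assumes "f \<in> Arr C" "c \<in> Arr C" "Dom C c = Cod C f" "c \<cdot> f = null (Dom C f) (Cod C c)" "epic C c"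
    and "\<And>g. g \<in> Arr C \<Longrightarrow> Dom C g = Cod C f \<Longrightarrow> g \<cdot> f = null (Dom C f) (Cod C g) \<Longrightarrow>
      \<exists>u \<in> Arr C. Dom C u = Cod C c \<and> Cod C u = Cod C g \<and> u \<cdot> c = g"
  shows "is_cokernel C f c"
proof -
  have "\<exists>!u. u \<in> Hom C (Cod C c) X \<and> u \<cdot> c = g"
    if "g \<in> Hom C (Cod C f) X" "g \<cdot> f = null (Dom C f) X" for X g
  proof (rule ex_ex1I)
    show "\<exists>u. u \<in> Hom C (Cod C c) X \<and> u \<cdot> c = g"
      using assms(6)[of g] that by (auto simp: Hom_def)
    show "u = v" if "u \<in> Hom C (Cod C c) X \<and> u \<cdot> c = g" "v \<in> Hom C (Cod C c) X \<and> v \<cdot> c = g" for u v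
      using epicD[OF assms(5), of u v] that by (auto simp: Hom_def)
  qed
  then show ?thesis
    using assms(1-4) by (simp add: is_cokernel_def is_kernel_def Hom_dual zero_mor_dual)
qed

text \<open>The kernel is the pullback of \<open>f\<close> along the morphism from the zero object.
  The projection \<open>z\<close> to that object carries no information, so \<open>k\<close> alone
  is monic.\<close>

lemma kernel_exists:
  assumes lim: "has_finite_limits C" and f: "f \<in> Arr C"
  shows "\<exists>k. is_kernel C f k"
proof -
  obtain Z where Z: "is_zero_object C Z"
    using pointed by (auto simp: pointed_def)
  then have Z_obj: "Z \<in> Obj C"
    by (simp add: is_zero_object_def is_terminal_def)
  let ?B = "Cod C f"
  obtain K k z where K: "is_pullback C f (null Z ?B) K k z"
    using pullback_exists[OF lim, of f "null Z ?B"] f Z_obj by auto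
  note k = pullback_arr[OF K]
  have to_Z: "u = v" if "u \<in> Arr C" "v \<in> Arr C" "Dom C u = Dom C v" "Cod C u = Z" "Cod C v = Z" for u v
  proof -
    have "\<exists>!h. h \<in> Hom C (Dom C v) Z"
      using Z that by (simp add: is_zero_object_def is_terminal_def)
    then show ?thesis
      using that by (auto simp: Hom_def)
  qed
  have "is_kernel C f k"
  proof (rule is_kernelI)
    show "f \<cdot> k = null (Dom C k) (Cod C f)"
      using k f Z_obj by simp
    have "u = v" if uv: "u \<in> Hom C X (Dom C k)" "v \<in> Hom C X (Dom C k)" "k \<cdot> u = k \<cdot> v" for X u v
    proof -
      have arr: "u \<in> Arr C" "v \<in> Arr C" "Dom C u = X" "Dom C v = X" "Cod C u = K" "Cod C v = K"
        using uv k by (auto simp: Hom_def)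
      have "z \<cdot> u = z \<cdot> v"
        by (rule to_Z) (use arr k Z_obj f in simp_all)
      then show ?thesis
        using pullback_ext[OF K, of u v] arr uv(3) by simp
    qed
    then show "monic C k"
      using k by (simp add: monic_def)
    show "\<exists>u \<in> Arr C. Dom C u = Dom C g \<and> Cod C u = Dom C k \<and> k \<cdot> u = g"
      if g: "g \<in> Arr C" "Cod C g = Dom C f" "f \<cdot> g = null (Dom C g) (Cod C f)" for g
      by (rule pullback_factor[OF K, of g "null (Dom C g) Z"]) (use g f k Z_obj in auto)
  qed (use k in auto)
  then show ?thesis ..
qed

end

locale pointed_sums = pointed_category C for C :: "('o, 'm) cat" (structure) +
  assumes sums: "has_binary_coproducts C"
begin

definition sum_diagram :: "'o \<Rightarrow> 'o \<Rightarrow> 'o \<times> 'm \<times> 'm" where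
  "sum_diagram A B = (SOME (S, i, j). is_product (dual C) A B S i j)"

definition Sum :: "'o \<Rightarrow> 'o \<Rightarrow> 'o" where
  "Sum A B = fst (sum_diagram A B)"

definition inj1 :: "'o \<Rightarrow> 'o \<Rightarrow> 'm" where
  "inj1 A B = fst (snd (sum_diagram A B))"

definition inj2 :: "'o \<Rightarrow> 'o \<Rightarrow> 'm" where
  "inj2 A B = snd (snd (sum_diagram A B))"

text \<open>Encoded as a \<open>pairing\<close> in the dual, so that the morphisms in the
  subtractivity of \<open>dual C\<close> are copairs by definition.\<close>

definition copair :: "'m \<Rightarrow> 'm \<Rightarrow> 'm"  (infix "\<triangledown>" 68) where
  "f \<triangledown> g = pairing (dual C) (inj1 (Dom C f) (Dom C g)) (inj2 (Dom C f) (Dom C g)) f g"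

lemma sum_is_product:
  assumes "A \<in> Obj C" "B \<in> Obj C"
  shows "is_product (dual C) A B (Sum A B) (inj1 A B) (inj2 A B)"
proof -
  have "\<exists>x. case x of (S, i, j) \<Rightarrow> is_product (dual C) A B S i j"
    using sums assms by (auto simp: has_binary_coproducts_def has_binary_products_def)
  from someI_ex[OF this] show ?thesis
    by (auto simp: sum_diagram_def Sum_def inj1_def inj2_def split: prod.splits)
qed

lemma inj_arr [simp]:
  assumes "A \<in> Obj C" "B \<in> Obj C"
  shows "inj1 A B \<in> Arr C" "Dom C (inj1 A B) = A" "Cod C (inj1 A B) = Sum A B"
    "inj2 A B \<in> Arr C" "Dom C (inj2 A B) = B" "Cod C (inj2 A B) = Sum A B"
  using sum_is_product[OF assms] by (auto simp: is_product_def Hom_dual Hom_def)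

lemma Sum_obj [simp]: "A \<in> Obj C \<Longrightarrow> B \<in> Obj C \<Longrightarrow> Sum A B \<in> Obj C"
  using cod_obj[of "inj1 A B"] by simp

lemma sum_ext:
  assumes "h \<in> Arr C" "k \<in> Arr C" "Dom C h = Sum A B" "Dom C k = Sum A B" "Cod C h = Cod C k"
    and "A \<in> Obj C" "B \<in> Obj C"
    and "h \<cdot> inj1 A B = k \<cdot> inj1 A B" "h \<cdot> inj2 A B = k \<cdot> inj2 A B"
  shows "h = k"
proof -
  have "h \<cdot> inj1 A B \<in> Hom (dual C) (Cod C h) A" "h \<cdot> inj2 A B \<in> Hom (dual C) (Cod C h) B"
    using assms by (auto simp: Hom_dual Hom_def)
  then have "\<exists>!l. l \<in> Hom (dual C) (Cod C h) (Sum A B) \<and>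
      inj1 A B \<cdot>\<^bsub>dual C\<^esub> l = h \<cdot> inj1 A B \<and> inj2 A B \<cdot>\<^bsub>dual C\<^esub> l = h \<cdot> inj2 A B"
    using sum_is_product[OF assms(6,7)] unfolding is_product_def by blast
  then show ?thesis
    using assms(1-5,8,9) by (auto simp: Hom_dual Hom_def)
qed

lemma copair:
  assumes "f \<in> Arr C" "g \<in> Arr C" "Cod C f = Cod C g"
  shows copair_arr [simp]: "f \<triangledown> g \<in> Arr C" "Dom C (f \<triangledown> g) = Sum (Dom C f) (Dom C g)"
      "Cod C (f \<triangledown> g) = Cod C g"
    and copair_inj: "(f \<triangledown> g) \<cdot> inj1 (Dom C f) (Dom C g) = f"
      "(f \<triangledown> g) \<cdot> inj2 (Dom C f) (Dom C g) = g"
proof -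
  have S: "is_product (dual C) (Dom C f) (Dom C g) (Sum (Dom C f) (Dom C g))
      (inj1 (Dom C f) (Dom C g)) (inj2 (Dom C f) (Dom C g))"
    using assms by (simp add: sum_is_product)
  have fg: "f \<in> Hom (dual C) (Cod C g) (Dom C f)" "g \<in> Hom (dual C) (Cod C g) (Dom C g)"
    using assms by (auto simp: Hom_dual Hom_def)
  then obtain h where h: "h \<in> Hom (dual C) (Cod C g) (Sum (Dom C f) (Dom C g))"
    "inj1 (Dom C f) (Dom C g) \<cdot>\<^bsub>dual C\<^esub> h = f" "inj2 (Dom C f) (Dom C g) \<cdot>\<^bsub>dual C\<^esub> h = g"
    using S unfolding is_product_def by blast
  then have "f \<triangledown> g = h"
    unfolding copair_def by (intro pairing_eqI[OF S]) (use fg in auto)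
  then show "f \<triangledown> g \<in> Arr C" "Dom C (f \<triangledown> g) = Sum (Dom C f) (Dom C g)" "Cod C (f \<triangledown> g) = Cod C g"
    "(f \<triangledown> g) \<cdot> inj1 (Dom C f) (Dom C g) = f" "(f \<triangledown> g) \<cdot> inj2 (Dom C f) (Dom C g) = g"
    using h by (auto simp: Hom_dual Hom_def)
qed

lemma copair_simps [simp]:
  assumes "f \<in> Arr C" "g \<in> Arr C" "Cod C f = Cod C g" "Dom C f = A" "Dom C g = B"
  shows "(f \<triangledown> g) \<cdot> inj1 A B = f" "(f \<triangledown> g) \<cdot> inj2 A B = g"
    "h \<in> Arr C \<Longrightarrow> Cod C h = A \<Longrightarrow> (f \<triangledown> g) \<cdot> (inj1 A B \<cdot> h) = f \<cdot> h"
    "h \<in> Arr C \<Longrightarrow> Cod C h = B \<Longrightarrow> (f \<triangledown> g) \<cdot> (inj2 A B \<cdot> h) = g \<cdot> h"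
proof -
  show inj: "(f \<triangledown> g) \<cdot> inj1 A B = f" "(f \<triangledown> g) \<cdot> inj2 A B = g"
    using copair_inj[OF assms(1-3)] assms(4,5) by auto
  have "A \<in> Obj C" "B \<in> Obj C"
    using assms by auto
  then show "(f \<triangledown> g) \<cdot> (inj1 A B \<cdot> h) = f \<cdot> h" if "h \<in> Arr C" "Cod C h = A"
    using assms that by (intro comp_fold[OF inj(1)]) simp_all
  show "(f \<triangledown> g) \<cdot> (inj2 A B \<cdot> h) = g \<cdot> h" if "h \<in> Arr C" "Cod C h = B"
    using assms that \<open>A \<in> Obj C\<close> \<open>B \<in> Obj C\<close> by (intro comp_fold[OF inj(2)]) simp_all
qed

text \<open>Postcomposition moves into the components, which makes copairs the normal form of
  morphisms out of a sum.\<close>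

lemma comp_copair [simp]:
  assumes "f \<in> Arr C" "g \<in> Arr C" "Cod C f = Cod C g" "h \<in> Arr C" "Dom C h = Cod C g"
  shows "h \<cdot> (f \<triangledown> g) = (h \<cdot> f) \<triangledown> (h \<cdot> g)"
  by (rule sum_ext[of _ _ "Dom C f" "Dom C g"]) (use assms in auto)

lemma comp_copair_comp [simp]:
  assumes "f \<in> Arr C" "g \<in> Arr C" "Cod C f = Cod C g" "h \<in> Arr C" "Dom C h = Cod C g"
    and "k \<in> Arr C" "Cod C k = Sum (Dom C f) (Dom C g)"
  shows "h \<cdot> ((f \<triangledown> g) \<cdot> k) = ((h \<cdot> f) \<triangledown> (h \<cdot> g)) \<cdot> k"
  using assms by (metis comp_assoc comp_copair copair_arr)

lemma copair_inj_inj [simp]: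
  assumes "A \<in> Obj C" "B \<in> Obj C"
  shows "inj1 A B \<triangledown> inj2 A B = Ident C (Sum A B)"
  by (rule sum_ext[of _ _ A B]) (use assms in auto)

end

section \<open>Regular categories that are subtractive in both directions\<close>

locale regular_bisubtractive = category C for C :: "('o, 'm) cat" (structure) +
  assumes regular: "regular_category C"
    and sub: "subtractive C"
    and dual_sub: "subtractive (dual C)"

sublocale regular_bisubtractive \<subseteq> pointed_sums
  using sub dual_sub
  by unfold_locales (auto simp: subtractive_def has_binary_coproducts_def)

section \<open>Partial subtraction and the term condition\<close>

context regular_bisubtractive
begin

text \<open>The image \<open>R\<close> of the morphism \<open>A + A \<rightarrow> A \<times> A\<close> with rows \<open>(1, 1)\<close> and \<open>(1, 0)\<close> is a subobject
  to which subtractivity applies and a quotient to which dual subtractivity applies. In terms of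
  elements, \<open>\<sigma>\<close> is a partial subtraction that is a homomorphism defined on \<open>R\<close>.\<close>

lemma partial_subtraction:
  assumes A: "A \<in> Obj C"
  obtains R q r\<^sub>1 r\<^sub>2 s \<sigma> where "regular_epi C q" "q \<in> Arr C" "Dom C q = Sum A A" "Cod C q = R"
    "r\<^sub>1 \<in> Arr C" "Dom C r\<^sub>1 = R" "Cod C r\<^sub>1 = A" "r\<^sub>2 \<in> Arr C" "Dom C r\<^sub>2 = R" "Cod C r\<^sub>2 = A"
    "r\<^sub>1 \<cdot> q = Ident C A \<triangledown> Ident C A" "r\<^sub>2 \<cdot> q = Ident C A \<triangledown> null A A"
    "\<And>u v. u \<in> Arr C \<Longrightarrow> v \<in> Arr C \<Longrightarrow> Dom C u = Dom C v \<Longrightarrow> Cod C u = R \<Longrightarrow> Cod C v = R \<Longrightarrow>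
      r\<^sub>1 \<cdot> u = r\<^sub>1 \<cdot> v \<Longrightarrow> r\<^sub>2 \<cdot> u = r\<^sub>2 \<cdot> v \<Longrightarrow> u = v"
    "s \<in> Arr C" "Dom C s = A" "Cod C s = R" "r\<^sub>1 \<cdot> s = null A A" "r\<^sub>2 \<cdot> s = Ident C A"
    "\<sigma> \<in> Arr C" "Dom C \<sigma> = R" "Cod C \<sigma> = A" "\<sigma> \<cdot> q = null A A \<triangledown> Ident C A"
proof -
  obtain P p\<^sub>1 p\<^sub>2 where P: "is_product C A A P p\<^sub>1 p\<^sub>2"
    using sub A unfolding subtractive_def has_binary_products_def by blast
  then have p: "p\<^sub>1 \<in> Arr C" "Dom C p\<^sub>1 = P" "Cod C p\<^sub>1 = A" "p\<^sub>2 \<in> Arr C" "Dom C p\<^sub>2 = P" "Cod C p\<^sub>2 = A"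
    by (auto simp: is_product_def Hom_def)
  have P_ex: "\<exists>!h. h \<in> Hom C X P \<and> p\<^sub>1 \<cdot> h = f \<and> p\<^sub>2 \<cdot> h = g"
    if "f \<in> Hom C X A" "g \<in> Hom C X A" for X f g
    using P that by (simp add: is_product_def)
  have P_ext: "u = v" if "u \<in> Arr C" "v \<in> Arr C" "Dom C u = Dom C v" "Cod C u = P" "Cod C v = P"
    "p\<^sub>1 \<cdot> u = p\<^sub>1 \<cdot> v" "p\<^sub>2 \<cdot> u = p\<^sub>2 \<cdot> v" for u v
    using P_ex[of "p\<^sub>1 \<cdot> v" "Dom C v" "p\<^sub>2 \<cdot> v"] that p by (auto simp: Hom_def)
  obtain h where h: "h \<in> Arr C" "Dom C h = Sum A A" "Cod C h = P"
    "p\<^sub>1 \<cdot> h = Ident C A \<triangledown> Ident C A" "p\<^sub>2 \<cdot> h = Ident C A \<triangledown> null A A"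
    using ex1_implies_ex[OF P_ex[of "Ident C A \<triangledown> Ident C A" "Sum A A" "Ident C A \<triangledown> null A A"]] A
    by (auto simp: Hom_def)
  obtain a b q r where qr: "is_coequalizer C a b q" "monic C r" "q \<in> Arr C" "r \<in> Arr C"
    "Dom C q = Dom C h" "Cod C q = Dom C r" "Cod C r = Cod C h" "h = r \<cdot> q"
    using image_factorization[OF regular h(1)] by metis
  have q_reg: "regular_epi C q"
    using qr(1) by (auto simp: regular_epi_def)
  have qr': "Dom C q = Sum A A" "Cod C r = P" "p\<^sub>1 \<cdot> (r \<cdot> q) = Ident C A \<triangledown> Ident C A"
    "p\<^sub>2 \<cdot> (r \<cdot> q) = Ident C A \<triangledown> null A A"
    using qr(5,7,8) h by auto
  have pair: "pairing C p\<^sub>1 p\<^sub>2 f g = w"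
    if "w \<in> Arr C" "Dom C w = A" "Cod C w = P" "p\<^sub>1 \<cdot> w = f" "p\<^sub>2 \<cdot> w = g" for f g w
    by (rule pairing_eqI[OF P]) (use that p in \<open>auto simp: Hom_def\<close>)
  have r_hom: "r \<in> Hom C (Cod C q) P"
    using qr by (auto simp: Hom_def qr'(2))
  have inj: "q \<cdot> inj1 A A \<in> Hom C A (Cod C q)" "q \<cdot> inj2 A A \<in> Hom C A (Cod C q)"
    using A qr(3) qr'(1) by (auto simp: Hom_def)
  have comp_inj: "p\<^sub>1 \<cdot> (r \<cdot> (q \<cdot> inj1 A A)) = Ident C A" "p\<^sub>2 \<cdot> (r \<cdot> (q \<cdot> inj1 A A)) = Ident C A"
    "p\<^sub>1 \<cdot> (r \<cdot> (q \<cdot> inj2 A A)) = Ident C A" "p\<^sub>2 \<cdot> (r \<cdot> (q \<cdot> inj2 A A)) = null A A"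
    using A p qr(3,4,6) qr'(1,2) comp_fold[OF qr'(3), of "inj1 A A"] comp_fold[OF qr'(4), of "inj1 A A"]
      comp_fold[OF qr'(3), of "inj2 A A"] comp_fold[OF qr'(4), of "inj2 A A"] by simp_all
  have "r \<cdot> (q \<cdot> inj1 A A) = pairing C p\<^sub>1 p\<^sub>2 (Ident C A) (Ident C A)"
    "r \<cdot> (q \<cdot> inj2 A A) = pairing C p\<^sub>1 p\<^sub>2 (Ident C A) (null A A)"
    by (rule pair[symmetric]; use A comp_inj qr(3,4,6) qr'(1,2) in simp)+
  \<comment> \<open>Subtractivity for \<open>r\<close>: the columns of the matrix, lifted to
    \<open>q \<cdot> inj1 A A\<close> and \<open>q \<cdot> inj2 A A\<close>, are the two given
    morphisms.\<close>
  then have "\<exists>s \<in> Hom C A (Cod C q). r \<cdot> s = pairing C p\<^sub>1 p\<^sub>2 (null A A) (Ident C A)"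
    using sub P qr(2) r_hom inj unfolding subtractive_def by blast
  moreover obtain w where w: "w \<in> Hom C A P" "p\<^sub>1 \<cdot> w = null A A" "p\<^sub>2 \<cdot> w = Ident C A"
    using ex1_implies_ex[OF P_ex[of "null A A" A "Ident C A"]] A by (auto simp: Hom_def)
  ultimately obtain s where s: "s \<in> Arr C" "Dom C s = A" "Cod C s = Cod C q" "r \<cdot> s = w"
    using pair[of w] by (auto simp: Hom_def)
  have "epic C q"
    using q_reg by (rule regular_epi_epic)
  \<comment> \<open>Dual subtractivity for \<open>q\<close>: the rows of the matrix factor through
    \<open>q\<close> by \<open>p\<^sub>1 \<cdot> r\<close> and
    \<open>p\<^sub>2 \<cdot> r\<close>.\<close>
  then have "monic (dual C) q" "q \<in> Hom (dual C) (Cod C q) (Sum A A)"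
    "p\<^sub>1 \<cdot> r \<in> Hom (dual C) A (Cod C q)" "p\<^sub>2 \<cdot> r \<in> Hom (dual C) A (Cod C q)"
    "q \<cdot>\<^bsub>dual C\<^esub> (p\<^sub>1 \<cdot> r) = pairing (dual C) (inj1 A A) (inj2 A A) (Ident (dual C) A) (Ident (dual C) A)"
    "q \<cdot>\<^bsub>dual C\<^esub> (p\<^sub>2 \<cdot> r) =
      pairing (dual C) (inj1 A A) (inj2 A A) (Ident (dual C) A) (zero_mor (dual C) A A)"
    using A p qr(3,4,6) qr' by (simp_all add: epic_def Hom_dual Hom_def zero_mor_dual copair_def)
  then have "\<exists>\<sigma> \<in> Hom (dual C) A (Cod C q). q \<cdot>\<^bsub>dual C\<^esub> \<sigma> =
      pairing (dual C) (inj1 A A) (inj2 A A) (zero_mor (dual C) A A) (Ident (dual C) A)"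
    using dual_sub sum_is_product[OF A A] unfolding subtractive_def by blast
  then obtain \<sigma> where \<sigma>: "\<sigma> \<in> Arr C" "Dom C \<sigma> = Cod C q" "Cod C \<sigma> = A" "\<sigma> \<cdot> q = null A A \<triangledown> Ident C A"
    using A by (auto simp: Hom_dual Hom_def zero_mor_dual copair_def)
  show thesis
  proof (rule that[OF q_reg qr(3) qr'(1) refl, of "p\<^sub>1 \<cdot> r" "p\<^sub>2 \<cdot> r" s \<sigma>])
    show "u = v" if "u \<in> Arr C" "v \<in> Arr C" "Dom C u = Dom C v" "Cod C u = Cod C q" "Cod C v = Cod C q"
      "(p\<^sub>1 \<cdot> r) \<cdot> u = (p\<^sub>1 \<cdot> r) \<cdot> v" "(p\<^sub>2 \<cdot> r) \<cdot> u = (p\<^sub>2 \<cdot> r) \<cdot> v" for u v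
    proof (rule monicD[OF qr(2)])
      show "r \<cdot> u = r \<cdot> v"
        by (rule P_ext) (use that p qr(4,6) qr'(2) in simp_all)
    qed (use that qr(6) in simp_all)
  qed (use p qr(3,4,6) qr' s w \<sigma> in \<open>simp_all\<close>)
qed

text \<open>In terms of elements: a term \<open>t(a, b)\<close> with \<open>t(a, 0) = 0\<close> satisfies \<open>t(a, b) = t(0, b)\<close>. Indeed
  \<open>\<sigma>\<close> maps \<open>(t(a, b), t(a, 0))\<close> to \<open>t(0, b)\<close>, and it maps \<open>(x, 0)\<close> to \<open>x\<close>.\<close>

lemma term_condition:
  assumes u: "u \<in> Arr C" "Cod C u = Sum A B" and AB: "A \<in> Obj C" "B \<in> Obj C"
    and null: "(Ident C A \<triangledown> null B A) \<cdot> u = null (Dom C u) A"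
  shows "inj2 A B \<cdot> ((null A B \<triangledown> Ident C B) \<cdot> u) = u"
proof -
  define E where "E = Sum A B"
  have E: "E \<in> Obj C" "Sum A B = E"
    using AB by (auto simp: E_def)
  obtain R q r\<^sub>1 r\<^sub>2 s \<sigma> where q: "regular_epi C q" "q \<in> Arr C" "Dom C q = Sum E E" "Cod C q = R"
    and r: "r\<^sub>1 \<in> Arr C" "Dom C r\<^sub>1 = R" "Cod C r\<^sub>1 = E" "r\<^sub>2 \<in> Arr C" "Dom C r\<^sub>2 = R" "Cod C r\<^sub>2 = E"
    and rq: "r\<^sub>1 \<cdot> q = Ident C E \<triangledown> Ident C E" "r\<^sub>2 \<cdot> q = Ident C E \<triangledown> null E E"
    and ext: "\<And>u v. u \<in> Arr C \<Longrightarrow> v \<in> Arr C \<Longrightarrow> Dom C u = Dom C v \<Longrightarrow> Cod C u = R \<Longrightarrow> Cod C v = R \<Longrightarrow>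
      r\<^sub>1 \<cdot> u = r\<^sub>1 \<cdot> v \<Longrightarrow> r\<^sub>2 \<cdot> u = r\<^sub>2 \<cdot> v \<Longrightarrow> u = v"
    and s: "s \<in> Arr C" "Dom C s = E" "Cod C s = R" "r\<^sub>1 \<cdot> s = null E E" "r\<^sub>2 \<cdot> s = Ident C E"
    and \<sigma>: "\<sigma> \<in> Arr C" "Dom C \<sigma> = R" "Cod C \<sigma> = E" "\<sigma> \<cdot> q = null E E \<triangledown> Ident C E"
    by (rule partial_subtraction[OF E(1)]) (rule that)
  \<comment> \<open>\<open>t\<close> sends A to the first copy of \<open>E\<close> and B to the
    second, so the rows (1, 1), (1, 0) and (0, 1) applied to \<open>t \<cdot> u\<close> keep both
    arguments of the term \<open>u\<close>, only the first, only the second.\<close>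
  define t where "t = (inj1 E E \<cdot> inj1 A B) \<triangledown> (inj2 E E \<cdot> inj2 A B)"
  have t: "t \<in> Arr C" "Dom C t = E" "Cod C t = Sum E E"
    using AB E by (auto simp: t_def)
  note fold = comp_fold[OF rq(1)] comp_fold[OF rq(2)] comp_fold[OF \<sigma>(4)]
  have "(inj1 A B \<triangledown> null B E) \<cdot> u = inj1 A B \<cdot> ((Ident C A \<triangledown> null B A) \<cdot> u)"
    using AB E u by simp
  then have null': "(inj1 A B \<triangledown> null B E) \<cdot> u = null (Dom C u) E"
    using AB E u by (simp add: null del: comp_copair_comp)
  have "q \<cdot> (t \<cdot> u) = q \<cdot> (inj2 E E \<cdot> u)"
  proof (rule ext)
    show "r\<^sub>1 \<cdot> (q \<cdot> (t \<cdot> u)) = r\<^sub>1 \<cdot> (q \<cdot> (inj2 E E \<cdot> u))"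
      using AB E u q(2-4) r t by (simp add: fold) (simp add: t_def)
    show "r\<^sub>2 \<cdot> (q \<cdot> (t \<cdot> u)) = r\<^sub>2 \<cdot> (q \<cdot> (inj2 E E \<cdot> u))"
      using AB E u q(2-4) r t by (simp add: fold) (simp add: t_def null')
  qed (use AB E u q(2-4) t in simp_all)
  then have "\<sigma> \<cdot> (q \<cdot> (t \<cdot> u)) = \<sigma> \<cdot> (q \<cdot> (inj2 E E \<cdot> u))"
    by simp
  then have "(null E E \<triangledown> Ident C E) \<cdot> (t \<cdot> u) = u"
    using AB E u q(2-4) \<sigma>(1-3) t by (simp add: fold)
  then show ?thesis
    using AB E u by (simp add: t_def)
qed

section \<open>Subtraction on a regular cover\<close>

text \<open>A subtraction term exists only after passing to the regular epimorphism \<open>p\<close>: for an element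
  \<open>x\<close> of \<open>Dom p\<close>, the value of \<open>d\<close> at \<open>x\<close> is a term \<open>t(a, b)\<close> with \<open>t(p x, p x) = 0\<close>, \<open>t(p x, 0) = p x\<close>
  and \<open>t(0, p x) = n x\<close>.\<close>

definition subtraction_cover :: "'o \<Rightarrow> 'm \<Rightarrow> 'm \<Rightarrow> 'm \<Rightarrow> bool" where
  "subtraction_cover A p d n \<longleftrightarrow> A \<in> Obj C \<and> regular_epi C p \<and>
     p \<in> Arr C \<and> Cod C p = A \<and> d \<in> Arr C \<and> Dom C d = Dom C p \<and> Cod C d = Sum A A \<and>
     n \<in> Arr C \<and> Dom C n = Dom C p \<and> Cod C n = A \<and>
     (Ident C A \<triangledown> Ident C A) \<cdot> d = null (Dom C p) A \<and>
     (Ident C A \<triangledown> null A A) \<cdot> d = p \<and> (null A A \<triangledown> Ident C A) \<cdot> d = n"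

lemma subtraction_cover_exists:
  assumes "A \<in> Obj C"
  obtains p d n where "subtraction_cover A p d n"
proof -
  obtain R q r\<^sub>1 r\<^sub>2 s \<sigma> where q: "regular_epi C q" "q \<in> Arr C" "Dom C q = Sum A A" "Cod C q = R"
    and r: "r\<^sub>1 \<in> Arr C" "Dom C r\<^sub>1 = R" "Cod C r\<^sub>1 = A" "r\<^sub>2 \<in> Arr C" "Dom C r\<^sub>2 = R" "Cod C r\<^sub>2 = A"
    and rq: "r\<^sub>1 \<cdot> q = Ident C A \<triangledown> Ident C A" "r\<^sub>2 \<cdot> q = Ident C A \<triangledown> null A A"
    and ext: "\<And>u v. u \<in> Arr C \<Longrightarrow> v \<in> Arr C \<Longrightarrow> Dom C u = Dom C v \<Longrightarrow> Cod C u = R \<Longrightarrow> Cod C v = R \<Longrightarrow>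
      r\<^sub>1 \<cdot> u = r\<^sub>1 \<cdot> v \<Longrightarrow> r\<^sub>2 \<cdot> u = r\<^sub>2 \<cdot> v \<Longrightarrow> u = v"
    and s: "s \<in> Arr C" "Dom C s = A" "Cod C s = R" "r\<^sub>1 \<cdot> s = null A A" "r\<^sub>2 \<cdot> s = Ident C A"
    and \<sigma>: "\<sigma> \<in> Arr C" "Dom C \<sigma> = R" "Cod C \<sigma> = A" "\<sigma> \<cdot> q = null A A \<triangledown> Ident C A"
    by (rule partial_subtraction[OF assms]) (rule that)
  \<comment> \<open>\<open>s\<close> need not factor through \<open>q\<close>, but it does after a
    change of domain along \<open>p\<close>. The two components of \<open>s\<close> become the
    equations for \<open>d\<close> with (1, 1) and (1, 0).\<close>
  obtain p d where pd: "regular_epi C p" "p \<in> Arr C" "d \<in> Arr C" "Dom C d = Dom C p"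
      "Cod C p = Dom C s" "Cod C d = Dom C q" "q \<cdot> d = s \<cdot> p"
    using regular_epi_lift[OF regular q(1) s(1)] s q by metis
  have "(Ident C A \<triangledown> Ident C A) \<cdot> d = r\<^sub>1 \<cdot> (q \<cdot> d)" "(Ident C A \<triangledown> null A A) \<cdot> d = r\<^sub>2 \<cdot> (q \<cdot> d)"
    using assms q(2-4) r pd(2-6) by (simp_all add: comp_fold[OF rq(1)] comp_fold[OF rq(2)])
  then have "(Ident C A \<triangledown> Ident C A) \<cdot> d = null (Dom C p) A" "(Ident C A \<triangledown> null A A) \<cdot> d = p"
    unfolding pd(7) using assms s(1-3) r pd(2-6) by (simp_all add: comp_fold[OF s(4)] comp_fold[OF s(5)])
  then have "subtraction_cover A p d ((null A A \<triangledown> Ident C A) \<cdot> d)"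
    using assms pd(1-6) s(2) q(3) by (simp add: subtraction_cover_def)
  then show thesis
    by (rule that)
qed

lemma subtraction_coverD:
  assumes "subtraction_cover A p d n"
  shows "A \<in> Obj C" "regular_epi C p" "p \<in> Arr C" "Cod C p = A" "d \<in> Arr C" "Dom C d = Dom C p"
    "Cod C d = Sum A A" "n \<in> Arr C" "Dom C n = Dom C p" "Cod C n = A" "epic C p"
    "(Ident C A \<triangledown> Ident C A) \<cdot> d = null (Dom C p) A" "(Ident C A \<triangledown> null A A) \<cdot> d = p"
    "(null A A \<triangledown> Ident C A) \<cdot> d = n"
  using assms by (simp_all add: subtraction_cover_def regular_epi_epic)

text \<open>The defining equations postcomposed with \<open>h\<close>; the left sides have the form
  to which \<open>comp_copair\<close> brings such composites, so that they serve as rewrite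
  rules.\<close>

lemma subtraction_cover_comp:
  assumes c: "subtraction_cover A p d n" and h: "h \<in> Arr C" "Dom C h = A" "Cod C h = B"
  shows "(h \<triangledown> h) \<cdot> d = null (Dom C p) B" "(h \<triangledown> null A B) \<cdot> d = h \<cdot> p"
    "(null A B \<triangledown> h) \<cdot> d = h \<cdot> n"
proof -
  note c = subtraction_coverD[OF c]
  have B: "B \<in> Obj C"
    using h by auto
  have "h \<cdot> ((Ident C A \<triangledown> Ident C A) \<cdot> d) = (h \<triangledown> h) \<cdot> d"
    "h \<cdot> ((Ident C A \<triangledown> null A A) \<cdot> d) = (h \<triangledown> null A B) \<cdot> d"
    "h \<cdot> ((null A A \<triangledown> Ident C A) \<cdot> d) = (null A B \<triangledown> h) \<cdot> d"
    using c(1,3-10) h B by simp_all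
  then show "(h \<triangledown> h) \<cdot> d = null (Dom C p) B" "(h \<triangledown> null A B) \<cdot> d = h \<cdot> p"
    "(null A B \<triangledown> h) \<cdot> d = h \<cdot> n"
    unfolding c(12-14) using c(1,3) h by simp_all
qed

text \<open>In terms of elements, \<open>a - (a - b) = b\<close>, with the special case \<open>- - b = b\<close>. The term
  \<open>a - (a - b)\<close> vanishes for \<open>b = 0\<close>, so it does not depend on \<open>a\<close>; now put \<open>a = b\<close>.\<close>

lemma subtraction_cover_twice:
  assumes c: "subtraction_cover A p d n" and c': "subtraction_cover (Dom C p) p' d' n'"
  shows "((inj1 A A \<cdot> p) \<triangledown> d) \<cdot> d' = inj2 A A \<cdot> (p \<cdot> p')" "n \<cdot> n' = p \<cdot> p'"
proof -
  note pd = subtraction_coverD[OF c] and pd' = subtraction_coverD[OF c']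
  note cc = subtraction_cover_comp[OF c] subtraction_cover_comp[OF c']
  \<comment> \<open>The term a - (a - b): \<open>d\<close> stands for a - b and is substituted for
    the second argument of the subtraction \<open>d'\<close>. As \<open>d\<close> lives on
    \<open>Dom C p\<close>, the outer subtraction is one for that object, which costs a second cover
    \<open>p'\<close>.\<close>
  define w where "w = ((inj1 A A \<cdot> p) \<triangledown> d) \<cdot> d'"
  have w: "w \<in> Arr C" "Dom C w = Dom C p'" "Cod C w = Sum A A"
    using pd(1,3-10) pd'(1,3-10) by (simp_all add: w_def)
  \<comment> \<open>The values of this term at b = 0, at a = b and at a = 0.\<close>
  have w1: "(Ident C A \<triangledown> null A A) \<cdot> w = null (Dom C p') A" "(Ident C A \<triangledown> Ident C A) \<cdot> w = p \<cdot> p'"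
    "(null A A \<triangledown> Ident C A) \<cdot> w = n \<cdot> n'"
    using pd(1,3-10) pd'(1,3-10) by (simp_all add: w_def cc)
  then have w2: "inj2 A A \<cdot> ((null A A \<triangledown> Ident C A) \<cdot> w) = w"
    using term_condition[of w A A] w pd(1) by simp
  then have "(Ident C A \<triangledown> Ident C A) \<cdot> (inj2 A A \<cdot> (n \<cdot> n')) = p \<cdot> p'"
    using w1 by simp
  then show nn: "n \<cdot> n' = p \<cdot> p'"
    using pd(1,3-10) pd'(1,3-10) by simp
  show "((inj1 A A \<cdot> p) \<triangledown> d) \<cdot> d' = inj2 A A \<cdot> (p \<cdot> p')"
    using w2 unfolding w1(3) nn by (simp add: w_def)
qed

section \<open>The sum as a product\<close>

text \<open>Write u - v for \<open>(u \<triangledown> v) \<cdot> d\<close>. Both projections of u -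
  v vanish, and by \<open>term_condition\<close> it is determined by the second one, so u - v = 0.
  Then u = u - (u - v) = v on the cover \<open>p \<cdot> p'\<close>, which is epic.\<close>

lemma sum_projections_monic:
  assumes u: "u \<in> Arr C" "Cod C u = Sum A B" and v: "v \<in> Arr C" "Cod C v = Sum A B"
    and AB: "A \<in> Obj C" "B \<in> Obj C" and "Dom C u = Dom C v"
    and eq: "(Ident C A \<triangledown> null B A) \<cdot> u = (Ident C A \<triangledown> null B A) \<cdot> v"
      "(null A B \<triangledown> Ident C B) \<cdot> u = (null A B \<triangledown> Ident C B) \<cdot> v"
  shows "u = v"
proof -
  obtain p d n where c: "subtraction_cover (Dom C v) p d n"
    using subtraction_cover_exists[of "Dom C v"] v by auto
  note pd = subtraction_coverD[OF c]
  obtain p' d' n' where c': "subtraction_cover (Dom C p) p' d' n'"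
    using subtraction_cover_exists[of "Dom C p"] pd by auto
  note pd' = subtraction_coverD[OF c']
  note cc = subtraction_cover_comp[OF c] subtraction_cover_comp[OF c']
  have "inj2 A B \<cdot> ((null A B \<triangledown> Ident C B) \<cdot> ((u \<triangledown> v) \<cdot> d)) = (u \<triangledown> v) \<cdot> d"
    by (rule term_condition) (use u v AB assms(7) pd(1,3-10) eq in \<open>simp_all add: cc\<close>)
  moreover have "(null A B \<triangledown> Ident C B) \<cdot> ((u \<triangledown> v) \<cdot> d) = null (Dom C p) B"
    using u v AB assms(7) pd(1,3-10) eq by (simp add: cc)
  ultimately have uv: "(u \<triangledown> v) \<cdot> d = null (Dom C p) (Sum A B)"
    using AB pd(3) by simp
  have "(u \<triangledown> v) \<cdot> (((inj1 (Dom C v) (Dom C v) \<cdot> p) \<triangledown> d) \<cdot> d') = u \<cdot> (p \<cdot> p')"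
    using u v AB assms(7) pd(1,3-10) pd'(1,3-10) uv by (simp add: cc)
  moreover have "(u \<triangledown> v) \<cdot> (inj2 (Dom C v) (Dom C v) \<cdot> (p \<cdot> p')) = v \<cdot> (p \<cdot> p')"
    using u v AB assms(7) pd(1,3-10) pd'(1,3-10) by simp
  ultimately have upp: "u \<cdot> (p \<cdot> p') = v \<cdot> (p \<cdot> p')"
    using subtraction_cover_twice(1)[OF c c'] by simp
  have "epic C (p \<cdot> p')"
    using pd pd' by (intro epic_comp) auto
  then show "u = v"
    by (rule epicD[OF _ _ _ _ _ _ upp]) (use u v assms(7) pd(3,4) pd'(3,4) in simp_all)
qed

text \<open>The projections of \<open>f\<close> factor through \<open>e\<close> and are jointly
  monic, so \<open>f\<close> identifies all that \<open>e\<close> identifies and factors as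
  well.\<close>

lemma sum_projections_descend:
  assumes e: "regular_epi C e" and f: "f \<in> Arr C" "Dom C f = Dom C e" "Cod C f = Sum A B"
    and x: "x \<in> Arr C" "Dom C x = Cod C e" "Cod C x = A"
    and y: "y \<in> Arr C" "Dom C y = Cod C e" "Cod C y = B"
    and eq: "(Ident C A \<triangledown> null B A) \<cdot> f = x \<cdot> e" "(null A B \<triangledown> Ident C B) \<cdot> f = y \<cdot> e"
  obtains h where "h \<in> Arr C" "Dom C h = Cod C e" "Cod C h = Sum A B"
    "(Ident C A \<triangledown> null B A) \<cdot> h = x" "(null A B \<triangledown> Ident C B) \<cdot> h = y"
proof -
  have AB: "A \<in> Obj C" "B \<in> Obj C"
    using x y by auto
  have e': "e \<in> Arr C" "epic C e"
    using regular_epi_epic[OF e] by (auto simp: epic_iff)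
  have "f \<cdot> a = f \<cdot> b"
    if ab: "a \<in> Arr C" "b \<in> Arr C" "Dom C a = Dom C b" "Cod C a = Dom C e" "Cod C b = Dom C e"
      "e \<cdot> a = e \<cdot> b" for a b
  proof (rule sum_projections_monic)
    show "(Ident C A \<triangledown> null B A) \<cdot> (f \<cdot> a) = (Ident C A \<triangledown> null B A) \<cdot> (f \<cdot> b)"
      "(null A B \<triangledown> Ident C B) \<cdot> (f \<cdot> a) = (null A B \<triangledown> Ident C B) \<cdot> (f \<cdot> b)"
      using AB e' f x y ab by (simp_all add: comp_fold[OF eq(1)] comp_fold[OF eq(2)])
  qed (use f AB ab in auto)
  then obtain h where h: "h \<in> Arr C" "Dom C h = Cod C e" "Cod C h = Cod C f" "h \<cdot> e = f"
    using regular_epi_factor[OF e f(1,2)] by metis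
  have "(Ident C A \<triangledown> null B A) \<cdot> h = x"
    by (rule epicD[OF e'(2)]) (use AB e' f x h eq in simp_all)
  moreover have "(null A B \<triangledown> Ident C B) \<cdot> h = y"
    by (rule epicD[OF e'(2)]) (use AB e' f y h eq in simp_all)
  ultimately show thesis
    using that h f(3) by metis
qed

lemma sum_pairing_exists:
  assumes x: "x \<in> Arr C" "Cod C x = A" and y: "y \<in> Arr C" "Cod C y = B" and "Dom C x = Dom C y"
  obtains h where "h \<in> Arr C" "Dom C h = Dom C y" "Cod C h = Sum A B"
    "(Ident C A \<triangledown> null B A) \<cdot> h = x" "(null A B \<triangledown> Ident C B) \<cdot> h = y"
proof -
  have AB: "A \<in> Obj C" "B \<in> Obj C"
    using x y by auto
  obtain p d n where c: "subtraction_cover (Dom C y) p d n"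
    using subtraction_cover_exists[of "Dom C y"] y by auto
  note pd = subtraction_coverD[OF c]
  obtain p' d' n' where c': "subtraction_cover (Dom C p) p' d' n'"
    using subtraction_cover_exists[of "Dom C p"] pd by auto
  note pd' = subtraction_coverD[OF c']
  \<comment> \<open>The pair (x, y) is formed as (x, 0) - (0, -y), since so far only subtraction is
    available; \<open>n \<cdot> n' = p \<cdot> p'\<close> removes the double sign.\<close>
  define f where "f = ((inj1 A B \<cdot> (x \<cdot> p)) \<triangledown> (inj2 A B \<cdot> (y \<cdot> n))) \<cdot> d'"
  have f: "f \<in> Arr C" "Dom C f = Dom C p'" "Cod C f = Sum A B"
    using AB x y assms(5) pd(1,3-10) pd'(1,3-10) by (simp_all add: f_def)
  have "(Ident C A \<triangledown> null B A) \<cdot> f = (x \<cdot> p) \<cdot> p'" "(null A B \<triangledown> Ident C B) \<cdot> f = (y \<cdot> p) \<cdot> p'"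
    using AB x y assms(5) pd(1,3-10) pd'(1,3-10)
    by (simp_all add: f_def subtraction_cover_comp[OF c'] subtraction_cover_twice(2)[OF c c'])
  \<comment> \<open>The descent goes along \<open>p'\<close> and then along \<open>p\<close>, one
    regular epimorphism at a time, because composites of covers are known here only to be
    epic.\<close>
  then obtain g where g: "g \<in> Arr C" "Dom C g = Dom C p" "Cod C g = Sum A B"
    "(Ident C A \<triangledown> null B A) \<cdot> g = x \<cdot> p" "(null A B \<triangledown> Ident C B) \<cdot> g = y \<cdot> p"
    using sum_projections_descend[OF pd'(2) f, of "x \<cdot> p" "y \<cdot> p"] x y assms(5) pd pd' by auto
  then show thesis
    using sum_projections_descend[OF pd(2) g(1-3), of x y] x y assms(5) pd that by metis
qed

section \<open>Addition of morphisms\<close>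

text \<open>The sum is also a product, and \<open>f \<oplus> g\<close> is the morphism \<open>(f, g)\<close> followed by the codiagonal. The
  description is meaningful only for parallel \<open>f\<close> and \<open>g\<close>.\<close>

definition plus :: "'m \<Rightarrow> 'm \<Rightarrow> 'm"  (infixl "\<oplus>" 65) where
  "f \<oplus> g = (Ident C (Cod C g) \<triangledown> Ident C (Cod C g)) \<cdot>
     (THE h. h \<in> Hom C (Dom C g) (Sum (Cod C g) (Cod C g)) \<and>
       (Ident C (Cod C g) \<triangledown> null (Cod C g) (Cod C g)) \<cdot> h = f \<and>
       (null (Cod C g) (Cod C g) \<triangledown> Ident C (Cod C g)) \<cdot> h = g)"

lemma plus_eqI:
  assumes h: "h \<in> Arr C" "Cod C h = Sum B B" and B: "B \<in> Obj C"
    and eq: "(Ident C B \<triangledown> null B B) \<cdot> h = f" "(null B B \<triangledown> Ident C B) \<cdot> h = g"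
  shows "f \<oplus> g = (Ident C B \<triangledown> Ident C B) \<cdot> h"
proof -
  have g: "Dom C g = Dom C h" "Cod C g = B"
    using h B by (simp_all flip: eq(2))
  have "(THE h'. h' \<in> Hom C (Dom C h) (Sum B B) \<and> (Ident C B \<triangledown> null B B) \<cdot> h' = f \<and>
      (null B B \<triangledown> Ident C B) \<cdot> h' = g) = h"
  proof (rule the_equality)
    show "h' = h" if "h' \<in> Hom C (Dom C h) (Sum B B) \<and> (Ident C B \<triangledown> null B B) \<cdot> h' = f \<and>
      (null B B \<triangledown> Ident C B) \<cdot> h' = g" for h'
      by (rule sum_projections_monic[of _ B B]) (use that h B eq in \<open>auto simp: Hom_def\<close>)
  qed (use h eq in \<open>auto simp: Hom_def\<close>)
  then show ?thesis
    by (simp add: plus_def g)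
qed

text \<open>The rule "row times column". With \<open>k\<close> the sum of the morphisms
  \<open>a\<close> and \<open>b\<close>, the copair is the codiagonal after \<open>k\<close>, and
  the components of \<open>k \<cdot> h\<close> are the two summands.\<close>

lemma copair_comp_eq_plus:
  assumes h: "h \<in> Arr C" "Cod C h = Sum A A'"
    and a: "a \<in> Arr C" "Dom C a = A" and b: "b \<in> Arr C" "Dom C b = A'" and "Cod C a = Cod C b"
  shows "(a \<triangledown> b) \<cdot> h = (a \<cdot> ((Ident C A \<triangledown> null A' A) \<cdot> h)) \<oplus> (b \<cdot> ((null A A' \<triangledown> Ident C A') \<cdot> h))"
proof -
  have obj: "A \<in> Obj C" "A' \<in> Obj C" "Cod C b \<in> Obj C"
    using a b by auto
  define k where "k = (inj1 (Cod C b) (Cod C b) \<cdot> a) \<triangledown> (inj2 (Cod C b) (Cod C b) \<cdot> b)"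
  have k: "k \<in> Arr C" "Dom C k = Sum A A'" "Cod C k = Sum (Cod C b) (Cod C b)"
    using assms obj by (simp_all add: k_def)
  have "(a \<cdot> ((Ident C A \<triangledown> null A' A) \<cdot> h)) \<oplus> (b \<cdot> ((null A A' \<triangledown> Ident C A') \<cdot> h)) =
      (Ident C (Cod C b) \<triangledown> Ident C (Cod C b)) \<cdot> (k \<cdot> h)"
    by (rule plus_eqI) (use assms obj k in \<open>simp_all add: k_def\<close>)
  then show ?thesis
    using assms obj k by (simp add: k_def)
qed

lemma plus_arr [simp]:
  assumes "f \<in> Arr C" "g \<in> Arr C" "Dom C f = Dom C g" "Cod C f = Cod C g"
  shows "f \<oplus> g \<in> Arr C" "Dom C (f \<oplus> g) = Dom C g" "Cod C (f \<oplus> g) = Cod C g"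
proof -
  obtain h where h: "h \<in> Arr C" "Dom C h = Dom C g" "Cod C h = Sum (Cod C g) (Cod C g)"
    "(Ident C (Cod C g) \<triangledown> null (Cod C g) (Cod C g)) \<cdot> h = f"
    "(null (Cod C g) (Cod C g) \<triangledown> Ident C (Cod C g)) \<cdot> h = g"
    using sum_pairing_exists[of f "Cod C g" g "Cod C g"] assms by metis
  have "f \<oplus> g = (Ident C (Cod C g) \<triangledown> Ident C (Cod C g)) \<cdot> h"
    by (rule plus_eqI) (use assms h in simp_all)
  then show "f \<oplus> g \<in> Arr C" "Dom C (f \<oplus> g) = Dom C g" "Cod C (f \<oplus> g) = Cod C g"
    using h assms by simp_all
qed

lemma plus_comp:
  assumes fg: "f \<in> Arr C" "g \<in> Arr C" "Dom C f = Dom C g" "Cod C f = Cod C g"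
    and k: "k \<in> Arr C" "Cod C k = Dom C g"
  shows "(f \<oplus> g) \<cdot> k = (f \<cdot> k) \<oplus> (g \<cdot> k)"
proof -
  let ?B = "Cod C g"
  obtain h where h: "h \<in> Arr C" "Dom C h = Dom C g" "Cod C h = Sum ?B ?B"
    "(Ident C ?B \<triangledown> null ?B ?B) \<cdot> h = f" "(null ?B ?B \<triangledown> Ident C ?B) \<cdot> h = g"
    using sum_pairing_exists[of f ?B g ?B] fg by metis
  have "f \<oplus> g = (Ident C ?B \<triangledown> Ident C ?B) \<cdot> h"
    by (rule plus_eqI) (use fg h in simp_all)
  moreover have "(f \<cdot> k) \<oplus> (g \<cdot> k) = (Ident C ?B \<triangledown> Ident C ?B) \<cdot> (h \<cdot> k)"
    by (rule plus_eqI) (use fg h(1-3) k in \<open>simp_all add: comp_fold[OF h(4)] comp_fold[OF h(5)]\<close>)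
  ultimately show ?thesis
    using fg h(1-3) k by simp
qed

lemma comp_plus:
  assumes fg: "f \<in> Arr C" "g \<in> Arr C" "Dom C f = Dom C g" "Cod C f = Cod C g"
    and k: "k \<in> Arr C" "Dom C k = Cod C g"
  shows "k \<cdot> (f \<oplus> g) = (k \<cdot> f) \<oplus> (k \<cdot> g)"
proof -
  let ?B = "Cod C g"
  obtain h where h: "h \<in> Arr C" "Dom C h = Dom C g" "Cod C h = Sum ?B ?B"
    "(Ident C ?B \<triangledown> null ?B ?B) \<cdot> h = f" "(null ?B ?B \<triangledown> Ident C ?B) \<cdot> h = g"
    using sum_pairing_exists[of f ?B g ?B] fg by metis
  have "f \<oplus> g = (Ident C ?B \<triangledown> Ident C ?B) \<cdot> h"
    by (rule plus_eqI) (use fg h in simp_all)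
  then have "k \<cdot> (f \<oplus> g) = (k \<triangledown> k) \<cdot> h"
    using fg h(1-3) k by simp
  also have "\<dots> = (k \<cdot> f) \<oplus> (k \<cdot> g)"
    using copair_comp_eq_plus[OF h(1,3) k k] h(4,5) by simp
  finally show ?thesis .
qed

lemma plus_null:
  assumes "f \<in> Arr C" "Dom C f = A" "Cod C f = B"
  shows "f \<oplus> null A B = f" "null A B \<oplus> f = f"
proof -
  have obj: "A \<in> Obj C" "B \<in> Obj C"
    using assms by auto
  have "f \<oplus> null A B = (Ident C B \<triangledown> Ident C B) \<cdot> (inj1 B B \<cdot> f)"
    "null A B \<oplus> f = (Ident C B \<triangledown> Ident C B) \<cdot> (inj2 B B \<cdot> f)"
    by (rule plus_eqI; use assms obj in simp)+
  then show "f \<oplus> null A B = f" "null A B \<oplus> f = f"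
    using assms obj by simp_all
qed

lemma plus_copair:
  assumes f: "f \<in> Arr C" "f' \<in> Arr C" "Dom C f' = Dom C f" "Cod C f' = Cod C f"
    and g: "g \<in> Arr C" "g' \<in> Arr C" "Dom C g' = Dom C g" "Cod C g = Cod C f" "Cod C g' = Cod C f"
  shows "(f \<oplus> f') \<triangledown> (g \<oplus> g') = (f \<triangledown> g) \<oplus> (f' \<triangledown> g')"
  by (rule sum_ext[of _ _ "Dom C f" "Dom C g"]) (use assms in \<open>simp_all add: plus_comp\<close>)

text \<open>For the diagonal \<open>h\<close>, that is the pair (1, 1),
  \<open>(x \<triangledown> y) \<cdot> h\<close> is \<open>x \<oplus> y\<close>. Copairs are added
  componentwise, so the two orders of adding agree.\<close>

lemma plus_interchange:
  assumes a: "a \<in> Arr C" "Dom C a = A" "Cod C a = B" and b: "b \<in> Arr C" "Dom C b = A" "Cod C b = B"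
    and c: "c \<in> Arr C" "Dom C c = A" "Cod C c = B" and d: "d \<in> Arr C" "Dom C d = A" "Cod C d = B"
  shows "(a \<oplus> b) \<oplus> (c \<oplus> d) = (a \<oplus> c) \<oplus> (b \<oplus> d)"
proof -
  have A: "A \<in> Obj C"
    using a by auto
  obtain h where h: "h \<in> Arr C" "Dom C h = A" "Cod C h = Sum A A"
    "(Ident C A \<triangledown> null A A) \<cdot> h = Ident C A" "(null A A \<triangledown> Ident C A) \<cdot> h = Ident C A"
    using sum_pairing_exists[of "Ident C A" A "Ident C A" A] A by (metis ident_arr)
  have copair: "(x \<triangledown> y) \<cdot> h = x \<oplus> y"
    if "x \<in> Arr C" "Dom C x = A" "Cod C x = B" "y \<in> Arr C" "Dom C y = A" "Cod C y = B" for x y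
    using copair_comp_eq_plus[OF h(1,3), of x y] that h(4,5) by simp
  have "((a \<oplus> b) \<triangledown> (c \<oplus> d)) \<cdot> h = ((a \<triangledown> c) \<cdot> h) \<oplus> ((b \<triangledown> d) \<cdot> h)"
    using assms h(1-3) by (simp add: plus_copair plus_comp)
  then show ?thesis
    using assms by (simp add: copair)
qed

text \<open>The Eckmann-Hilton argument: the interchange law with zeros inserted. Commutativity
  arises in the same way.\<close>

lemma plus_assoc:
  assumes "a \<in> Arr C" "Dom C a = A" "Cod C a = B" "b \<in> Arr C" "Dom C b = A" "Cod C b = B"
    "c \<in> Arr C" "Dom C c = A" "Cod C c = B"
  shows "(a \<oplus> b) \<oplus> c = a \<oplus> (b \<oplus> c)"
  using plus_interchange[of a A B b "null A B" c] assms by (auto simp: plus_null)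

lemma plus_commute:
  assumes "a \<in> Arr C" "Dom C a = A" "Cod C a = B" "b \<in> Arr C" "Dom C b = A" "Cod C b = B"
  shows "a \<oplus> b = b \<oplus> a"
  using plus_interchange[of "null A B" A B a b "null A B"] assms by (auto simp: plus_null)

section \<open>Negatives and the enrichment\<close>

text \<open>Negatives in a commutative monoid are unique, so \<open>n \<cdot> a\<close>, being the
  negative of \<open>p \<cdot> a\<close>, depends on \<open>p \<cdot> a\<close> only. Therefore
  \<open>n\<close> descends along \<open>p\<close>.\<close>

lemma negative_ident_exists:
  assumes A: "A \<in> Obj C"
  obtains n where "n \<in> Arr C" "Dom C n = A" "Cod C n = A" "n \<oplus> Ident C A = null A A"
proof -
  obtain p d n where c: "subtraction_cover A p d n"
    using subtraction_cover_exists[OF A] by metis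
  note pd = subtraction_coverD[OF c]
  \<comment> \<open>\<open>d\<close> has the components \<open>p\<close> and \<open>n\<close>, so
    their sum is the codiagonal after \<open>d\<close>.\<close>
  have pn: "p \<oplus> n = null (Dom C p) A"
    using plus_eqI[OF pd(5,7,1,13,14)] pd(12) by simp
  have "n \<cdot> a = n \<cdot> b"
    if ab: "a \<in> Arr C" "b \<in> Arr C" "Dom C a = Dom C b" "Cod C a = Dom C p" "Cod C b = Dom C p"
      "p \<cdot> a = p \<cdot> b" for a b
  proof -
    have null: "(p \<cdot> x) \<oplus> (n \<cdot> x) = null (Dom C x) A" if "x \<in> Arr C" "Cod C x = Dom C p" for x
      using plus_comp[of p n x] that pd pn by simp
    have "n \<cdot> a = (n \<cdot> a) \<oplus> ((p \<cdot> b) \<oplus> (n \<cdot> b))"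
      using null[of b] ab pd(1,3-10) by (simp add: plus_null)
    also have "\<dots> = ((p \<cdot> a) \<oplus> (n \<cdot> a)) \<oplus> (n \<cdot> b)"
      using ab pd(1,3-10) plus_assoc[of "n \<cdot> a" "Dom C b" A "p \<cdot> b" "n \<cdot> b"]
        plus_commute[of "n \<cdot> a" "Dom C b" A "p \<cdot> b"] by simp
    also have "\<dots> = n \<cdot> b"
      using null[of a] ab pd(1,3-10) by (simp add: plus_null)
    finally show ?thesis .
  qed
  then obtain m where m: "m \<in> Arr C" "Dom C m = A" "Cod C m = A" "m \<cdot> p = n"
    using regular_epi_factor[OF pd(2,8,9)] pd(4,10) by metis
  have "m \<oplus> Ident C A = null A A"
  proof (rule epicD[OF pd(11)])
    show "(m \<oplus> Ident C A) \<cdot> p = null A A \<cdot> p"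
      using m A pd(1,3-10) pn plus_commute[of p "Dom C p" A n] by (simp add: plus_comp)
  qed (use m A pd in simp_all)
  then show thesis
    using that m by metis
qed

definition plus_group :: "'o \<Rightarrow> 'o \<Rightarrow> 'm monoid" where
  "plus_group A B = \<lparr>carrier = Hom C A B, mult = (\<oplus>), one = null A B\<rparr>"

lemma plus_group_comm_group:
  assumes "A \<in> Obj C" "B \<in> Obj C"
  shows "comm_group (plus_group A B)"
proof (rule comm_groupI)
  fix f assume f: "f \<in> carrier (plus_group A B)"
  obtain n where n: "n \<in> Arr C" "Dom C n = B" "Cod C n = B" "n \<oplus> Ident C B = null B B"
    using negative_ident_exists[OF assms(2)] by metis
  have "(n \<oplus> Ident C B) \<cdot> f = (n \<cdot> f) \<oplus> f"
    using f n(1-3) assms by (subst plus_comp) (auto simp: plus_group_def Hom_def)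
  then show "\<exists>g \<in> carrier (plus_group A B). g \<otimes>\<^bsub>plus_group A B\<^esub> f = \<one>\<^bsub>plus_group A B\<^esub>"
    using f n assms by (intro bexI[of _ "n \<cdot> f"]) (auto simp: plus_group_def Hom_def)
qed (use assms in \<open>auto simp: plus_group_def Hom_def plus_null intro: plus_assoc plus_commute\<close>)

lemma ab_enrichment_plus_group: "ab_enrichment C plus_group"
  unfolding ab_enrichment_def
  by (auto simp: plus_group_comm_group) (auto simp: plus_group_def Hom_def comp_plus plus_comp)

lemma biproduct_sum:
  assumes A: "A \<in> Obj C" and B: "B \<in> Obj C"
  shows "is_biproduct C plus_group A B (Sum A B) (Ident C A \<triangledown> null B A) (null A B \<triangledown> Ident C B)
    (inj1 A B) (inj2 A B)"
proof -
  have "(inj1 A B \<cdot> (Ident C A \<triangledown> null B A)) \<oplus> (inj2 A B \<cdot> (null A B \<triangledown> Ident C B)) = Ident C (Sum A B)"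
    by (rule sum_ext[of _ _ A B]) (use A B in \<open>simp_all add: plus_comp plus_null\<close>)
  then show ?thesis
    using A B by (auto simp: is_biproduct_def plus_group_def Hom_def)
qed

lemma additive: "additive_category C"
  unfolding additive_category_def
  using category_axioms pointed ab_enrichment_plus_group biproduct_sum by blast

end

section \<open>Additive categories\<close>

text \<open>The enrichment is arbitrary and not the one built from sums, since an abelian category
  comes with the mere existence of one.\<close>

locale additive = pointed_category C for C :: "('o, 'm) cat" (structure) +
  fixes G :: "'o \<Rightarrow> 'o \<Rightarrow> 'm monoid"
  assumes enrichment: "ab_enrichment C G"
    and biproducts: "\<And>A B. A \<in> Obj C \<Longrightarrow> B \<in> Obj C \<Longrightarrow> \<exists>S p\<^sub>1 p\<^sub>2 i\<^sub>1 i\<^sub>2. is_biproduct C G A B S p\<^sub>1 p\<^sub>2 i\<^sub>1 i\<^sub>2"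

context additive
begin

definition add :: "'m \<Rightarrow> 'm \<Rightarrow> 'm"  (infixl "\<oplus>" 65) where
  "f \<oplus> g = f \<otimes>\<^bsub>G (Dom C g) (Cod C g)\<^esub> g"

definition neg :: "'m \<Rightarrow> 'm"  ("\<ominus>_" [81] 80) where
  "\<ominus>f = inv\<^bsub>G (Dom C f) (Cod C f)\<^esub> f"

lemma Hom_group:
  assumes "A \<in> Obj C" "B \<in> Obj C"
  shows "carrier (G A B) = Hom C A B" "comm_group (G A B)"
  using enrichment assms by (auto simp: ab_enrichment_def)

lemma arr_carrier: "f \<in> Arr C \<Longrightarrow> Dom C f = A \<Longrightarrow> Cod C f = B \<Longrightarrow> f \<in> carrier (G A B)"
  using Hom_group[of A B] by (auto simp: Hom_def)

lemma arr_group: "f \<in> Arr C \<Longrightarrow> comm_group (G (Dom C f) (Cod C f))"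
  by (simp add: Hom_group)

lemma add_arr [simp]:
  assumes "f \<in> Arr C" "g \<in> Arr C" "Dom C f = Dom C g" "Cod C f = Cod C g"
  shows "f \<oplus> g \<in> Arr C" "Dom C (f \<oplus> g) = Dom C g" "Cod C (f \<oplus> g) = Cod C g"
proof -
  interpret H: comm_group "G (Dom C g) (Cod C g)"
    using assms by (simp add: arr_group)
  have "f \<oplus> g \<in> carrier (G (Dom C g) (Cod C g))"
    using assms arr_carrier[of f] arr_carrier[of g] by (simp add: add_def)
  then show "f \<oplus> g \<in> Arr C" "Dom C (f \<oplus> g) = Dom C g" "Cod C (f \<oplus> g) = Cod C g"
    using assms by (auto simp: Hom_group Hom_def)
qed

lemma neg_arr [simp]:
  assumes "f \<in> Arr C"
  shows "\<ominus>f \<in> Arr C" "Dom C (\<ominus>f) = Dom C f" "Cod C (\<ominus>f) = Cod C f"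
proof -
  interpret H: comm_group "G (Dom C f) (Cod C f)"
    using assms by (simp add: arr_group)
  have "\<ominus>f \<in> carrier (G (Dom C f) (Cod C f))"
    using assms arr_carrier[of f] by (simp add: neg_def)
  then show "\<ominus>f \<in> Arr C" "Dom C (\<ominus>f) = Dom C f" "Cod C (\<ominus>f) = Cod C f"
    using assms by (auto simp: Hom_group Hom_def)
qed

lemma comp_add:
  assumes "f \<in> Arr C" "g \<in> Arr C" "Dom C f = Dom C g" "Cod C f = Cod C g" "k \<in> Arr C" "Dom C k = Cod C g"
  shows "k \<cdot> (f \<oplus> g) = (k \<cdot> f) \<oplus> (k \<cdot> g)"
  using enrichment assms unfolding ab_enrichment_def add_def by (auto simp: Hom_def)

lemma add_comp:
  assumes "f \<in> Arr C" "g \<in> Arr C" "Dom C f = Dom C g" "Cod C f = Cod C g" "k \<in> Arr C" "Cod C k = Dom C g"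
  shows "(f \<oplus> g) \<cdot> k = (f \<cdot> k) \<oplus> (g \<cdot> k)"
  using enrichment assms unfolding ab_enrichment_def add_def by (auto simp: Hom_def)

text \<open>The composite 0(0 + 0) is 0 + 0 by distributivity and 0 by absorption; an idempotent of
  a group is its unit.\<close>

lemma one_eq_null:
  assumes "A \<in> Obj C" "B \<in> Obj C"
  shows "\<one>\<^bsub>G A B\<^esub> = null A B"
proof -
  interpret H: comm_group "G A B"
    using assms by (simp add: Hom_group)
  have "null A B \<oplus> null A B = null B B \<cdot> (null A B \<oplus> null A B)"
    using assms by (simp add: comp_add)
  also have "\<dots> = null A B"
    using assms by (simp del: comp_null)
  finally have "null A B \<otimes>\<^bsub>G A B\<^esub> null A B = null A B"
    using assms by (simp add: add_def)
  then show ?thesis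
    using assms arr_carrier[of "null A B" A B] by (metis H.l_cancel_one null_arr)
qed

lemma add_null:
  assumes "f \<in> Arr C" "Dom C f = A" "Cod C f = B"
  shows "f \<oplus> null A B = f" "null A B \<oplus> f = f"
proof -
  interpret H: comm_group "G A B"
    using arr_group[OF assms(1)] assms by simp
  have AB: "A \<in> Obj C" "B \<in> Obj C"
    using assms by auto
  then have "f \<otimes>\<^bsub>G A B\<^esub> null A B = f" "null A B \<otimes>\<^bsub>G A B\<^esub> f = f"
    using arr_carrier[OF assms] by (simp_all flip: one_eq_null[of A B])
  then show "f \<oplus> null A B = f" "null A B \<oplus> f = f"
    using assms AB by (simp_all add: add_def)
qed

lemma add_neg:
  assumes "f \<in> Arr C"
  shows "f \<oplus> (\<ominus>f) = null (Dom C f) (Cod C f)" "(\<ominus>f) \<oplus> f = null (Dom C f) (Cod C f)"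
proof -
  interpret H: comm_group "G (Dom C f) (Cod C f)"
    using assms by (simp add: arr_group)
  show "f \<oplus> (\<ominus>f) = null (Dom C f) (Cod C f)" "(\<ominus>f) \<oplus> f = null (Dom C f) (Cod C f)"
    using assms arr_carrier[OF assms refl refl] neg_arr[OF assms]
    by (simp_all add: add_def, simp_all add: neg_def flip: one_eq_null)
qed

lemma add_assoc:
  assumes "f \<in> Arr C" "g \<in> Arr C" "h \<in> Arr C" "Dom C f = Dom C h" "Dom C g = Dom C h"
    "Cod C f = Cod C h" "Cod C g = Cod C h"
  shows "(f \<oplus> g) \<oplus> h = f \<oplus> (g \<oplus> h)"
proof -
  interpret H: comm_group "G (Dom C h) (Cod C h)"
    using assms by (simp add: arr_group)
  have "f \<oplus> g = f \<otimes>\<^bsub>G (Dom C h) (Cod C h)\<^esub> g" "f \<oplus> (g \<oplus> h) = f \<otimes>\<^bsub>G (Dom C h) (Cod C h)\<^esub> (g \<oplus> h)"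
    using assms by (simp_all add: add_def[of f])
  then show ?thesis
    using assms by (simp add: add_def[of _ h] H.m_assoc arr_carrier)
qed

lemma add_cancel:
  assumes "f \<in> Arr C" "g \<in> Arr C" "h \<in> Arr C" "Dom C f = Dom C h" "Dom C g = Dom C h"
    "Cod C f = Cod C h" "Cod C g = Cod C h" and eq: "f \<oplus> h = g \<oplus> h"
  shows "f = g"
proof -
  have "(f \<oplus> h) \<oplus> (\<ominus>h) = (g \<oplus> h) \<oplus> (\<ominus>h)"
    using eq by simp
  then show ?thesis
    using assms(1-7) by (simp add: add_assoc add_neg add_null)
qed

lemma comp_neg:
  assumes "f \<in> Arr C" "k \<in> Arr C" "Dom C k = Cod C f"
  shows "k \<cdot> (\<ominus>f) = \<ominus>(k \<cdot> f)"
  by (rule add_cancel[of _ _ "k \<cdot> f"]) (use assms in \<open>simp_all add: add_neg flip: comp_add\<close>)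

lemma neg_null: "A \<in> Obj C \<Longrightarrow> B \<in> Obj C \<Longrightarrow> \<ominus>(null A B) = null A B"
  using add_null(2)[of "\<ominus>(null A B)" A B] add_neg(1)[of "null A B"] by simp

section \<open>Biproducts\<close>

lemma biproduct_exists:
  assumes "A \<in> Obj C" "B \<in> Obj C"
  obtains S p\<^sub>1 p\<^sub>2 i\<^sub>1 i\<^sub>2 where "is_biproduct C G A B S p\<^sub>1 p\<^sub>2 i\<^sub>1 i\<^sub>2"
  using biproducts[OF assms] by blast

lemma biproductD:
  assumes "is_biproduct C G A B S p\<^sub>1 p\<^sub>2 i\<^sub>1 i\<^sub>2"
  shows "p\<^sub>1 \<in> Arr C" "Dom C p\<^sub>1 = S" "Cod C p\<^sub>1 = A" "p\<^sub>2 \<in> Arr C" "Dom C p\<^sub>2 = S" "Cod C p\<^sub>2 = B"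
    "i\<^sub>1 \<in> Arr C" "Dom C i\<^sub>1 = A" "Cod C i\<^sub>1 = S" "i\<^sub>2 \<in> Arr C" "Dom C i\<^sub>2 = B" "Cod C i\<^sub>2 = S"
    "p\<^sub>1 \<cdot> i\<^sub>1 = Ident C A" "p\<^sub>2 \<cdot> i\<^sub>2 = Ident C B" "(i\<^sub>1 \<cdot> p\<^sub>1) \<oplus> (i\<^sub>2 \<cdot> p\<^sub>2) = Ident C S"
  using assms by (auto simp: is_biproduct_def Hom_def add_def)

text \<open>\<open>is_biproduct\<close> does not state these equations. Inserting the decomposition
  of the identity into x = \<open>p\<^sub>2 \<cdot> i\<^sub>1\<close> gives x = x + x, hence x = 0;
  the other one is symmetric.\<close>

lemma biproduct_null:
  assumes "is_biproduct C G A B S p\<^sub>1 p\<^sub>2 i\<^sub>1 i\<^sub>2"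
  shows "p\<^sub>2 \<cdot> i\<^sub>1 = null A B" "p\<^sub>1 \<cdot> i\<^sub>2 = null B A"
proof -
  note b = biproductD[OF assms]
  have AB: "A \<in> Obj C" "B \<in> Obj C"
    using b by auto
  have "p\<^sub>2 \<cdot> (((i\<^sub>1 \<cdot> p\<^sub>1) \<oplus> (i\<^sub>2 \<cdot> p\<^sub>2)) \<cdot> i\<^sub>1) = (p\<^sub>2 \<cdot> i\<^sub>1) \<oplus> (p\<^sub>2 \<cdot> i\<^sub>1)"
    using b(1-14) AB by (simp add: add_comp comp_add comp_fold[OF b(14)])
  then have "null A B \<oplus> (p\<^sub>2 \<cdot> i\<^sub>1) = (p\<^sub>2 \<cdot> i\<^sub>1) \<oplus> (p\<^sub>2 \<cdot> i\<^sub>1)"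
    using b AB by (simp add: add_null)
  then show "p\<^sub>2 \<cdot> i\<^sub>1 = null A B"
    using b AB by (intro add_cancel[of "p\<^sub>2 \<cdot> i\<^sub>1" "null A B" "p\<^sub>2 \<cdot> i\<^sub>1"]) simp_all
  have "p\<^sub>1 \<cdot> (((i\<^sub>1 \<cdot> p\<^sub>1) \<oplus> (i\<^sub>2 \<cdot> p\<^sub>2)) \<cdot> i\<^sub>2) = (p\<^sub>1 \<cdot> i\<^sub>2) \<oplus> (p\<^sub>1 \<cdot> i\<^sub>2)"
    using b(1-14) AB by (simp add: add_comp comp_add comp_fold[OF b(13)])
  then have "null B A \<oplus> (p\<^sub>1 \<cdot> i\<^sub>2) = (p\<^sub>1 \<cdot> i\<^sub>2) \<oplus> (p\<^sub>1 \<cdot> i\<^sub>2)"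
    using b AB by (simp add: add_null)
  then show "p\<^sub>1 \<cdot> i\<^sub>2 = null B A"
    using b AB by (intro add_cancel[of "p\<^sub>1 \<cdot> i\<^sub>2" "null B A" "p\<^sub>1 \<cdot> i\<^sub>2"]) simp_all
qed

lemma biproduct_ext:
  assumes "is_biproduct C G A B S p\<^sub>1 p\<^sub>2 i\<^sub>1 i\<^sub>2"
    and u: "u \<in> Arr C" "Cod C u = S" and v: "v \<in> Arr C" "Cod C v = S" and "Dom C u = Dom C v"
    and eq: "p\<^sub>1 \<cdot> u = p\<^sub>1 \<cdot> v" "p\<^sub>2 \<cdot> u = p\<^sub>2 \<cdot> v"
  shows "u = v"
proof -
  note b = biproductD[OF assms(1)]
  have "((i\<^sub>1 \<cdot> p\<^sub>1) \<oplus> (i\<^sub>2 \<cdot> p\<^sub>2)) \<cdot> u = ((i\<^sub>1 \<cdot> p\<^sub>1) \<oplus> (i\<^sub>2 \<cdot> p\<^sub>2)) \<cdot> v"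
    using b(1-12) u v eq assms(6) by (simp add: add_comp)
  then show ?thesis
    unfolding b(15) using u v by simp
qed

lemma biproduct_pair:
  assumes "is_biproduct C G A B S p\<^sub>1 p\<^sub>2 i\<^sub>1 i\<^sub>2"
    and f: "f \<in> Arr C" "Cod C f = A" and g: "g \<in> Arr C" "Cod C g = B" and "Dom C f = Dom C g"
  shows "p\<^sub>1 \<cdot> ((i\<^sub>1 \<cdot> f) \<oplus> (i\<^sub>2 \<cdot> g)) = f" "p\<^sub>2 \<cdot> ((i\<^sub>1 \<cdot> f) \<oplus> (i\<^sub>2 \<cdot> g)) = g"
proof -
  note b = biproductD[OF assms(1)] and bn = biproduct_null[OF assms(1)]
  have AB: "A \<in> Obj C" "B \<in> Obj C"
    using b by auto
  show "p\<^sub>1 \<cdot> ((i\<^sub>1 \<cdot> f) \<oplus> (i\<^sub>2 \<cdot> g)) = f" "p\<^sub>2 \<cdot> ((i\<^sub>1 \<cdot> f) \<oplus> (i\<^sub>2 \<cdot> g)) = g"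
    using b(1-12) f g AB assms(6)
    by (simp_all add: comp_add add_null comp_fold[OF b(13)] comp_fold[OF b(14)] comp_fold[OF bn(1)] comp_fold[OF bn(2)])
qed

lemma biproduct_is_product:
  assumes "is_biproduct C G A B S p\<^sub>1 p\<^sub>2 i\<^sub>1 i\<^sub>2"
  shows "is_product C A B S p\<^sub>1 p\<^sub>2"
proof -
  note b = biproductD[OF assms]
  have "\<exists>!h. h \<in> Hom C X S \<and> p\<^sub>1 \<cdot> h = f \<and> p\<^sub>2 \<cdot> h = g"
    if fg: "f \<in> Hom C X A" "g \<in> Hom C X B" for X f g
  proof (rule ex1I[of _ "(i\<^sub>1 \<cdot> f) \<oplus> (i\<^sub>2 \<cdot> g)"])
    show "h = (i\<^sub>1 \<cdot> f) \<oplus> (i\<^sub>2 \<cdot> g)" if "h \<in> Hom C X S \<and> p\<^sub>1 \<cdot> h = f \<and> p\<^sub>2 \<cdot> h = g" for h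
      by (rule biproduct_ext[OF assms])
        (use b fg that biproduct_pair[OF assms, of f g] in \<open>auto simp: Hom_def\<close>)
  qed (use b fg biproduct_pair[OF assms, of f g] in \<open>auto simp: Hom_def\<close>)
  then show ?thesis
    using b by (auto simp: is_product_def Hom_def)
qed

lemma subtractive: "subtractive C"
proof -
  have "\<exists>f\<^sub>3 \<in> Hom C A R. r \<cdot> f\<^sub>3 = pairing C p q (null A A) (Ident C A)"
    if P: "is_product C A A P p q" and r: "r \<in> Hom C R P"
      and f\<^sub>1: "f\<^sub>1 \<in> Hom C A R" "r \<cdot> f\<^sub>1 = pairing C p q (Ident C A) (Ident C A)"
      and f\<^sub>2: "f\<^sub>2 \<in> Hom C A R" "r \<cdot> f\<^sub>2 = pairing C p q (Ident C A) (null A A)"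
    for A P p q R r f\<^sub>1 f\<^sub>2
  proof -
    have p: "p \<in> Hom C P A" "q \<in> Hom C P A"
      using P by (auto simp: is_product_def)
    have A: "A \<in> Obj C"
      using f\<^sub>1 by (auto simp: Hom_def)
    have pairing: "pairing C p q f g \<in> Hom C A P \<and> p \<cdot> pairing C p q f g = f \<and> q \<cdot> pairing C p q f g = g"
      if fg: "f \<in> Hom C A A" "g \<in> Hom C A A" for f g
    proof -
      obtain h where h: "h \<in> Hom C A P" "p \<cdot> h = f" "q \<cdot> h = g"
        using P fg unfolding is_product_def by blast
      then show ?thesis
        using pairing_eqI[OF P h fg] by simp
    qed
    have eq: "p \<cdot> (r \<cdot> f\<^sub>1) = Ident C A" "q \<cdot> (r \<cdot> f\<^sub>1) = Ident C A"
      "p \<cdot> (r \<cdot> f\<^sub>2) = Ident C A" "q \<cdot> (r \<cdot> f\<^sub>2) = null A A"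
      unfolding f\<^sub>1(2) f\<^sub>2(2) using pairing A by (auto simp: Hom_def)
    define f\<^sub>3 where "f\<^sub>3 = f\<^sub>1 \<oplus> (\<ominus>f\<^sub>2)"
    have f\<^sub>3: "f\<^sub>3 \<in> Hom C A R"
      using f\<^sub>1(1) f\<^sub>2(1) by (auto simp: f\<^sub>3_def Hom_def)
    have "p \<cdot> (r \<cdot> f\<^sub>3) = null A A" "q \<cdot> (r \<cdot> f\<^sub>3) = Ident C A"
      using f\<^sub>1(1) f\<^sub>2(1) r p A unfolding f\<^sub>3_def
      by (auto simp: Hom_def comp_add comp_neg eq add_neg neg_null add_null)
    then have "pairing C p q (null A A) (Ident C A) = r \<cdot> f\<^sub>3"
      by (intro pairing_eqI[OF P, of _ A]) (use r f\<^sub>3 A in \<open>auto simp: Hom_def\<close>)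
    then show ?thesis
      using f\<^sub>3 by metis
  qed
  moreover have "has_binary_products C"
    unfolding has_binary_products_def using biproduct_exists biproduct_is_product by metis
  ultimately show ?thesis
    unfolding subtractive_def using category_axioms pointed by blast
qed

end

lemma additive_categoryE:
  assumes "additive_category C"
  obtains G where "additive C G"
  using assms unfolding additive_category_def additive_def additive_axioms_def pointed_category_def
    pointed_category_axioms_def by blast

text \<open>The groups are transposed, and each biproduct keeps its object while projections and
  injections trade places.\<close>

lemma additive_category_dual:
  assumes "additive_category C"
  shows "additive_category (dual C)"
proof -
  obtain G where "additive C G"
    using assms by (rule additive_categoryE)
  then interpret additive C G .
  let ?H = "\<lambda>A B. G B A"
  have "ab_enrichment (dual C) ?H"
    using enrichment by (simp add: ab_enrichment_def Hom_dual)
  moreover have "\<exists>S p\<^sub>1 p\<^sub>2 i\<^sub>1 i\<^sub>2. is_biproduct (dual C) ?H A B S p\<^sub>1 p\<^sub>2 i\<^sub>1 i\<^sub>2"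
    if AB: "A \<in> Obj C" "B \<in> Obj C" for A B
  proof -
    obtain S p\<^sub>1 p\<^sub>2 i\<^sub>1 i\<^sub>2 where "is_biproduct C G A B S p\<^sub>1 p\<^sub>2 i\<^sub>1 i\<^sub>2"
      using biproducts[OF AB] by blast
    then have "is_biproduct (dual C) ?H A B S i\<^sub>1 i\<^sub>2 p\<^sub>1 p\<^sub>2"
      by (simp add: is_biproduct_def Hom_dual)
    then show ?thesis
      by blast
  qed
  moreover have "pointed (dual C)"
    using pointed by (simp add: pointed_def is_zero_object_dual)
  ultimately show ?thesis
    using category_dual[OF category_axioms] unfolding additive_category_def dual_simps by blast
qed

lemma additive_category_subtractive: "additive_category C \<Longrightarrow> subtractive C"
  by (metis additive_categoryE additive.subtractive)

section \<open>Exact additive categories\<close>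

locale exact_additive = additive +
  assumes exact: "barr_exact C"
begin

lemma regular: "regular_category C"
  using exact by (simp add: barr_exact_def)

section \<open>Monomorphisms as kernels\<close>

text \<open>The element \<open>(a, x)\<close> of \<open>M + A\<close> stands for the pair \<open>(x, m a + x)\<close> of congruent elements.\<close>

lemma monic_coset_relation:
  assumes m: "monic C m" "m \<in> Arr C" "Dom C m = M" "Cod C m = A"
    and S: "is_biproduct C G M A S p\<^sub>1 p\<^sub>2 i\<^sub>1 i\<^sub>2"
  shows "internal_equivalence C A S p\<^sub>2 ((m \<cdot> p\<^sub>1) \<oplus> p\<^sub>2)"
proof -
  note b = biproductD[OF S] and bn = biproduct_null[OF S]
  let ?r = "(m \<cdot> p\<^sub>1) \<oplus> p\<^sub>2"
  have obj: "M \<in> Obj C" "A \<in> Obj C"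
    using m by auto
  have r: "?r \<in> Arr C" "Dom C ?r = S" "Cod C ?r = A"
    using b m by simp_all
  have r_comp: "?r \<cdot> u = (m \<cdot> (p\<^sub>1 \<cdot> u)) \<oplus> (p\<^sub>2 \<cdot> u)" if "u \<in> Arr C" "Cod C u = S" for u
    using that b m by (simp add: add_comp)
  have jointly_monic: "u = v"
    if uv: "u \<in> Hom C Y S" "v \<in> Hom C Y S" "p\<^sub>2 \<cdot> u = p\<^sub>2 \<cdot> v" "?r \<cdot> u = ?r \<cdot> v" for Y u v
  proof -
    have arr: "u \<in> Arr C" "v \<in> Arr C" "Dom C u = Y" "Dom C v = Y" "Cod C u = S" "Cod C v = S"
      using uv by (auto simp: Hom_def)
    have "m \<cdot> (p\<^sub>1 \<cdot> u) = m \<cdot> (p\<^sub>1 \<cdot> v)"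
      by (rule add_cancel[of _ _ "p\<^sub>2 \<cdot> v"]) (use uv(3,4) arr b m in \<open>simp_all add: r_comp\<close>)
    then have "p\<^sub>1 \<cdot> u = p\<^sub>1 \<cdot> v"
      by (rule monicD[OF m(1), rotated -1]) (use arr b m in simp_all)
    then show ?thesis
      using biproduct_ext[OF S] arr uv(3) by simp
  qed
  \<comment> \<open>The element (0, x) stands for the pair (x, x).\<close>
  have reflexive: "\<exists>d \<in> Hom C A S. p\<^sub>2 \<cdot> d = Ident C A \<and> ?r \<cdot> d = Ident C A"
    using b bn m obj by (intro bexI[of _ i\<^sub>2]) (auto simp: r_comp add_null Hom_def)
  have symmetric: "\<exists>s \<in> Hom C S S. p\<^sub>2 \<cdot> s = ?r \<and> ?r \<cdot> s = p\<^sub>2"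
  proof -
    \<comment> \<open>(a, x) goes to (-a, m a + x).\<close>
    let ?s = "(i\<^sub>1 \<cdot> (\<ominus>p\<^sub>1)) \<oplus> (i\<^sub>2 \<cdot> ?r)"
    have s: "p\<^sub>1 \<cdot> ?s = \<ominus>p\<^sub>1" "p\<^sub>2 \<cdot> ?s = ?r"
      using biproduct_pair[OF S, of "\<ominus>p\<^sub>1" ?r] b r by simp_all
    have s_arr: "?s \<in> Arr C" "Dom C ?s = S" "Cod C ?s = S"
      using b r by simp_all
    have "?r \<cdot> ?s = ((\<ominus>(m \<cdot> p\<^sub>1)) \<oplus> (m \<cdot> p\<^sub>1)) \<oplus> p\<^sub>2"
      using b m s_arr by (simp only: r_comp s) (simp add: comp_neg add_assoc)
    also have "\<dots> = p\<^sub>2"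
      using b m by (simp add: add_neg add_null)
    finally show ?thesis
      using s s_arr by (auto simp: Hom_def)
  qed
  have transitive: "\<exists>t \<in> Hom C P S. p\<^sub>2 \<cdot> t = p\<^sub>2 \<cdot> p \<and> ?r \<cdot> t = ?r \<cdot> q"
    if P: "is_pullback C ?r p\<^sub>2 P p q" for P p q
  proof -
    note pq = pullback_arr[OF P]
    have pq': "p \<in> Arr C" "q \<in> Arr C" "Dom C p = P" "Dom C q = P" "Cod C p = S" "Cod C q = S"
      using pq r b by simp_all
    \<comment> \<open>For (a, x) and (b, y) with y = m a + x the composite is (b + a, x).\<close>
    let ?t = "(i\<^sub>1 \<cdot> ((p\<^sub>1 \<cdot> q) \<oplus> (p\<^sub>1 \<cdot> p))) \<oplus> (i\<^sub>2 \<cdot> (p\<^sub>2 \<cdot> p))"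
    have t: "p\<^sub>1 \<cdot> ?t = (p\<^sub>1 \<cdot> q) \<oplus> (p\<^sub>1 \<cdot> p)" "p\<^sub>2 \<cdot> ?t = p\<^sub>2 \<cdot> p"
      using biproduct_pair[OF S, of "(p\<^sub>1 \<cdot> q) \<oplus> (p\<^sub>1 \<cdot> p)" "p\<^sub>2 \<cdot> p"] b pq' by simp_all
    have t_arr: "?t \<in> Arr C" "Dom C ?t = P" "Cod C ?t = S"
      using b pq' by simp_all
    have "?r \<cdot> ?t = (m \<cdot> (p\<^sub>1 \<cdot> q)) \<oplus> (?r \<cdot> p)"
      using b m t_arr pq' by (simp only: r_comp t) (simp add: comp_add add_assoc)
    also have "\<dots> = ?r \<cdot> q"
      unfolding pq(10) using pq' by (simp add: r_comp)
    finally show ?thesis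
      using t(2) t_arr by (auto simp: Hom_def)
  qed
  show ?thesis
    unfolding internal_equivalence_def
    using b r jointly_monic reflexive symmetric transitive by (auto simp: Hom_def)
qed

text \<open>The legs of the coset relation differ by \<open>m \<cdot> p\<^sub>1\<close>, so a
  morphism kills \<open>m\<close> exactly when it identifies them, and the quotient by the relation
  is the cokernel of \<open>m\<close>. The kernel needs exactness: the quotient must identify no
  further pairs, and then the class of 0 is M.\<close>

lemma monic_quotient:
  assumes m: "monic C m" "m \<in> Arr C" "Dom C m = M" "Cod C m = A"
  obtains f where "is_kernel C f m" "is_cokernel C m f"
proof -
  have obj: "M \<in> Obj C" "A \<in> Obj C"
    using m by auto
  obtain S p\<^sub>1 p\<^sub>2 i\<^sub>1 i\<^sub>2 where S: "is_biproduct C G M A S p\<^sub>1 p\<^sub>2 i\<^sub>1 i\<^sub>2"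
    using biproduct_exists[OF obj] by metis
  note b = biproductD[OF S] and bn = biproduct_null[OF S]
  let ?r = "(m \<cdot> p\<^sub>1) \<oplus> p\<^sub>2"
  have r: "?r \<in> Arr C" "Dom C ?r = S" "Cod C ?r = A"
    using b m by simp_all
  have r_i: "?r \<cdot> i\<^sub>1 = m"
    using b bn m obj by (simp add: add_comp add_null)
  obtain f where f: "is_pullback C f f S p\<^sub>2 ?r"
    using exact monic_coset_relation[OF m S] unfolding barr_exact_def is_kernel_pair_def by blast
  then obtain e where e: "is_coequalizer C p\<^sub>2 ?r e"
    using regular unfolding regular_category_def is_kernel_pair_def by blast
  note f' = pullback_arr[OF f]
  have factor: "e \<in> Arr C" "Dom C e = A" "e \<cdot> p\<^sub>2 = e \<cdot> ?r"
    using e b by (auto simp: is_coequalizer_def)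
  have null: "h \<cdot> m = null M (Cod C h) \<longleftrightarrow> h \<cdot> p\<^sub>2 = h \<cdot> ?r" if h: "h \<in> Arr C" "Dom C h = A" for h
  proof
    assume hm: "h \<cdot> m = null M (Cod C h)"
    show "h \<cdot> p\<^sub>2 = h \<cdot> ?r"
      using h b(1-12) m(2-4) obj by (simp add: comp_add add_null comp_fold[OF hm])
  next
    assume "h \<cdot> p\<^sub>2 = h \<cdot> ?r"
    then have "h \<cdot> (p\<^sub>2 \<cdot> i\<^sub>1) = h \<cdot> (?r \<cdot> i\<^sub>1)"
      using h b r by (metis comp_assoc)
    then show "h \<cdot> m = null M (Cod C h)"
      unfolding r_i bn(1) using h obj by simp
  qed
  have "is_cokernel C m e"
  proof (rule is_cokernelI)
    show "e \<cdot> m = null (Dom C m) (Cod C e)"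
      using null factor m by simp
    show "\<exists>u \<in> Arr C. Dom C u = Cod C e \<and> Cod C u = Cod C g \<and> u \<cdot> e = g"
      if g: "g \<in> Arr C" "Dom C g = Cod C m" "g \<cdot> m = null (Dom C m) (Cod C g)" for g
    proof -
      have "g \<cdot> p\<^sub>2 = g \<cdot> ?r"
        using null[of g] g m by simp
      then show ?thesis
        using coequalizer_factor[OF e g(1)] g m b by metis
    qed
  qed (use m factor coequalizer_epic[OF e] in simp_all)
  moreover have "is_kernel C e m"
  proof (rule is_kernelI)
    show "e \<cdot> m = null (Dom C m) (Cod C e)"
      using null factor m by simp
    show "\<exists>u \<in> Arr C. Dom C u = Dom C g \<and> Cod C u = Dom C m \<and> m \<cdot> u = g"
      if g: "g \<in> Arr C" "Cod C g = Dom C e" "e \<cdot> g = null (Dom C g) (Cod C e)" for g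
    proof -
      have fA: "f \<in> Arr C" "Dom C f = A"
        using f' b by simp_all
      \<comment> \<open>\<open>f\<close> is merely some morphism with the relation as its kernel
        pair; it factors through the quotient \<open>e\<close>, so it kills whatever
        \<open>e\<close> kills.\<close>
      obtain w where w: "w \<in> Arr C" "Dom C w = Cod C e" "Cod C w = Cod C f" "w \<cdot> e = f"
        using coequalizer_factor[OF e fA(1) _ f'(10)] fA(2) b(6) by metis
      have fg: "f \<cdot> null (Dom C g) A = f \<cdot> g"
        using w(1-3) g factor(1,2) fA obj by (simp add: comp_fold[OF w(4), symmetric])
      \<comment> \<open>\<open>f\<close> identifies 0 and \<open>g\<close>, so (0, g) comes from an
        element \<open>h\<close> of \<open>S\<close>, and g = m a + 0 for the first component a of
        \<open>h\<close>.\<close>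
      obtain h where h: "h \<in> Arr C" "Dom C h = Dom C g" "Cod C h = S"
        "p\<^sub>2 \<cdot> h = null (Dom C g) A" "?r \<cdot> h = g"
        by (rule pullback_factor[OF f, of "null (Dom C g) A" g])
          (use g(1,2) factor(2) fA obj fg in auto)
      then have "m \<cdot> (p\<^sub>1 \<cdot> h) = g"
        using b m by (simp add: add_comp add_null)
      then show ?thesis
        using h b m by (intro bexI[of _ "p\<^sub>1 \<cdot> h"]) simp_all
    qed
  qed (use m factor in simp_all)
  ultimately show thesis
    using that by metis
qed

section \<open>Cokernels and epimorphisms\<close>

text \<open>As \<open>q\<close> is epic, a morphism kills \<open>f\<close> exactly when it kills the
  image \<open>r\<close>, so the cokernel of the monomorphism \<open>r\<close> serves for
  \<open>f\<close>.\<close>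

lemma cokernel_exists:
  assumes f: "f \<in> Arr C"
  shows "\<exists>c. is_cokernel C f c"
proof -
  obtain a b q r where q: "is_coequalizer C a b q" and r: "monic C r"
    and qr: "q \<in> Arr C" "r \<in> Arr C" "Dom C q = Dom C f" "Cod C q = Dom C r" "Cod C r = Cod C f" "f = r \<cdot> q"
    using image_factorization[OF regular f] by metis
  obtain c where c: "is_cokernel C r c"
    using monic_quotient[OF r qr(2) refl refl] by metis
  have null: "g \<cdot> f = null (Dom C f) (Cod C g) \<longleftrightarrow> g \<cdot> r = null (Dom C r) (Cod C g)"
    if g: "g \<in> Arr C" "Dom C g = Cod C f" for g
  proof -
    have gf: "g \<cdot> f = (g \<cdot> r) \<cdot> q"
      using g qr(1-5) by (simp flip: qr(6))
    have null: "null (Dom C f) (Cod C g) = null (Dom C r) (Cod C g) \<cdot> q"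
      using g qr(1-5) by simp
    show ?thesis
      unfolding gf null using epicD[OF coequalizer_epic[OF q], of "g \<cdot> r" "null (Dom C r) (Cod C g)"] g qr(1-5)
      by (auto simp del: comp_assoc null_comp)
  qed
  have "is_cokernel C f c \<longleftrightarrow> is_cokernel C r c"
    if "c \<in> Arr C" "Dom C c = Cod C f"
  proof -
    have "c \<cdot> f = null (Dom C f) (Cod C c) \<longleftrightarrow> c \<cdot> r = null (Dom C r) (Cod C c)"
      using null that by blast
    moreover have "g \<cdot> f = null (Dom C f) X \<longleftrightarrow> g \<cdot> r = null (Dom C r) X"
      if "g \<in> Hom C (Cod C f) X" for g X
      using null[of g] that by (auto simp: Hom_def)
    ultimately show ?thesis
      using f qr(2,5) by (simp add: is_cokernel_def is_kernel_def Hom_dual zero_mor_dual)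
  qed
  moreover have "c \<in> Arr C" "Dom C c = Cod C f"
    using c qr(5) by (simp_all add: is_cokernel_def is_kernel_def)
  ultimately show ?thesis
    using c by blast
qed

lemma epic_cokernel:
  assumes e: "epic C e"
  shows "\<exists>f. is_cokernel C f e"
proof -
  have e': "e \<in> Arr C"
    using e by (simp add: epic_iff)
  obtain a b q r where q: "is_coequalizer C a b q" and K: "is_kernel_pair C e (Dom C a) a b"
    and r: "monic C r" and qr: "q \<in> Arr C" "r \<in> Arr C" "Dom C q = Dom C e" "Cod C q = Dom C r"
      "Cod C r = Cod C e" "e = r \<cdot> q"
    using image_factorization[OF regular e'] by metis
  obtain f where f: "is_kernel C f r"
    using monic_quotient[OF r qr(2) refl refl] by metis
  then have f': "f \<in> Arr C" "Dom C f = Cod C e" "f \<cdot> r = null (Dom C r) (Cod C f)"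
    using qr(5) by (auto simp: is_kernel_def)
  have "f \<cdot> e = null (Cod C e) (Cod C f) \<cdot> e"
    unfolding qr(6) using qr(1-5) f' e' by (simp add: comp_fold[OF f'(3)])
  then have "f = null (Cod C e) (Cod C f)"
    by (rule epicD[OF e, rotated -1]) (use f' e' in simp_all)
  \<comment> \<open>The identity is killed by the zero morphism \<open>f\<close>, so it factors
    through the kernel \<open>r\<close>; the factor \<open>u\<close> is the inverse of
    \<open>r\<close>.\<close>
  then have "f \<cdot> Ident C (Cod C e) = null (Cod C e) (Cod C f)"
    using f' e' by simp
  moreover have "Ident C (Cod C e) \<in> Hom C (Cod C e) (Dom C f)"
    using e' f'(2) by (auto simp: Hom_def)
  ultimately obtain u where "u \<in> Hom C (Cod C e) (Dom C r)" "r \<cdot> u = Ident C (Cod C e)"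
    using f unfolding is_kernel_def by blast
  then have u: "u \<in> Arr C" "Dom C u = Cod C e" "Cod C u = Dom C r" "r \<cdot> u = Ident C (Cod C e)"
    by (auto simp: Hom_def)
  have "r \<cdot> (u \<cdot> r) = r \<cdot> Ident C (Dom C r)"
    using u qr(1-5) by (simp add: comp_fold[OF u(4)])
  then have ur: "u \<cdot> r = Ident C (Dom C r)"
    by (rule monicD[OF r, rotated -1]) (use u qr(1-5) in simp_all)
  have ab: "a \<in> Arr C" "b \<in> Arr C" "Dom C b = Dom C a" "Cod C a = Dom C e" "Cod C b = Dom C e" "e \<cdot> a = e \<cdot> b"
    using pullback_arr[OF K[unfolded is_kernel_pair_def]] by simp_all
  have "is_cokernel C (a \<oplus> (\<ominus>b)) e"
  proof (rule is_cokernelI)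
    show "e \<cdot> (a \<oplus> (\<ominus>b)) = null (Dom C (a \<oplus> (\<ominus>b))) (Cod C e)"
      using ab e' by (simp add: comp_add comp_neg add_neg)
    show "\<exists>w \<in> Arr C. Dom C w = Cod C e \<and> Cod C w = Cod C g \<and> w \<cdot> e = g"
      if g: "g \<in> Arr C" "Dom C g = Cod C (a \<oplus> (\<ominus>b))"
        "g \<cdot> (a \<oplus> (\<ominus>b)) = null (Dom C (a \<oplus> (\<ominus>b))) (Cod C g)" for g
    proof -
      have g': "Dom C g = Cod C a"
        using g ab by simp
      have "g \<cdot> a = g \<cdot> b"
        by (rule add_cancel[of _ _ "\<ominus>(g \<cdot> b)"])
          (use g ab in \<open>simp_all add: comp_add comp_neg add_neg\<close>)
      then obtain w where w: "w \<in> Arr C" "Dom C w = Cod C q" "Cod C w = Cod C g" "w \<cdot> q = g"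
        using coequalizer_factor[OF q g(1) g'] by metis
      \<comment> \<open>\<open>e\<close> is \<open>q\<close> followed by the invertible
        \<open>r\<close>, so the factor through \<open>q\<close> becomes one through
        \<open>e\<close> after composition with \<open>u\<close>.\<close>
      have "(w \<cdot> u) \<cdot> e = g"
        unfolding qr(6) using w u qr(1-5) by (simp add: comp_fold[OF ur])
      then show ?thesis
        using w u qr(1-5) by (intro bexI[of _ "w \<cdot> u"]) simp_all
    qed
  qed (use e e' ab in simp_all)
  then show ?thesis ..
qed

lemma abelian: "abelian_category C"
proof -
  have "additive_category C"
    unfolding additive_category_def using category_axioms pointed enrichment biproducts by blast
  moreover have "\<exists>f. is_kernel C f m" if "monic C m" for m
    using monic_quotient[OF that] that by (metis monic_def)
  ultimately show ?thesis
    unfolding abelian_category_def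
    using regular kernel_exists cokernel_exists epic_cokernel by (auto simp: regular_category_def)
qed

end

theorem corollary2p3:
  fixes C :: "('o, 'm) cat"
  assumes "barr_exact C"
    and "has_binary_coproducts C"
  shows "abelian_category C \<longleftrightarrow> subtractive C \<and> subtractive (dual C)"
proof
  assume "abelian_category C"
  then show "subtractive C \<and> subtractive (dual C)"
    by (simp add: abelian_category_def additive_category_subtractive additive_category_dual)
next
  assume sub: "subtractive C \<and> subtractive (dual C)"
  have "regular_category C"
    using assms(1) by (simp add: barr_exact_def)
  then interpret regular_bisubtractive C
    using sub by (simp add: regular_bisubtractive_def regular_bisubtractive_axioms_def regular_category_def)
  obtain G where "additive C G"
    using additive by (rule additive_categoryE)
  then have "exact_additive C G"
    using assms(1) by (simp add: exact_additive_def exact_additive_axioms_def)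
  then show "abelian_category C"
    by (rule exact_additive.abelian)
qed

end
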